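(* Let $\mathcal{A}$ be a combinatorial symmetric weakly irreducible $Z$-tensor of order $m$ and dimension $n$. Suppose the incidence matrix $B_{\mathcal{A}}$ of $\mathcal{A}$, regarded over $\mathbb{Z}_m$, has Smith normal form over $\mathbb{Z}_m$ with nonzero diagonal entries $d_1,\dots,d_r$ (where $1\le d_i\le m-1$, $d_i\mid d_{i+1}$, $d_i\mid m$). Then: (1) $1\le r\le n-1$; (2) $\mathbb{PV}_{\lambda_{\min}(\mathcal{A})}(\mathcal{A})$ is a $\mathbb{Z}_m$-module with decomposition $\mathbb{PV}_{\lambda_{\min}(\mathcal{A})}(\mathcal{A})\cong\bigoplus_{i:\,d_i\neq 1}\mathbb{Z}_{d_i}\oplus(n-1-r)\mathbb{Z}_m$; (3) $s(\mathcal{A})=|\mathbb{PV}_{\lambda_{\min}(\mathcal{A})}(\mathcal{A})|=m^{n-1-r}\prod_{i=1}^r d_i$.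
   Context: A real tensor $\mathcal{A}=(a_{i_1\cdots i_m})$ of order $m$, dimension $n$; $(\mathcal{A}x^{m-1})_i=\sum_{i_2,\dots,i_m}a_{ii_2\cdots i_m}x_{i_2}\cdots x_{i_m}$; $\mathcal{I}$ is the identity tensor; $\lambda$ is an eigenvalue with eigenvector $x\ne0$ if $\mathcal{A}x^{m-1}=\lambda x^{[m-1]}$ with $x^{[m-1]}=(x_i^{m-1})$. $\lambda_{\min}(\mathcal{A})$ is the least eigenvalue having a real eigenvector; $\rho$ is spectral radius; $\mathbb{PV}_\lambda(\mathcal{A})=\{x\in\mathbb{P}^{n-1}:\mathcal{A}x^{m-1}=\lambda x^{[m-1]}\}$. A $Z$-tensor: off-diagonal entries nonpositive, i.e. $\mathcal{A}=s\mathcal{I}-\mathcal{B}$, $s>0$, $\mathcal{B}\ge0$. Weakly irreducible: the digraph on $[n]$ with arc $i\to j$ ($j\neq i$) whenever $a_{ii_2\cdots i_m}\ne0$ for some indices with $j\in\{i_2,\dots,i_m\}$ is strongly connected. Combinatorial symmetric: the $0/1$ support tensor of $\mathcal{A}$ is invariant under permutations of indices. Incidence matrix: let $E(\mathcal{A})=\{(i_1,\dots,i_m):a_{i_1\cdots i_m}\neq0,\ i_1\le\cdots\le i_m\}$; $B_{\mathcal{A}}$ is the $|E(\mathcal{A})|\times n$ matrix with $b_{e,j}=|\{k\in[m]:i_k=j\}|$ for $e=(i_1,\dots,i_m)$. Smith normal form over $\mathbb{Z}_m$: invertible $P,Q$ over $\mathbb{Z}_m$ with $PB_{\mathcal{A}}Q$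 diagonal with entries $d_1,\dots,d_r,0,\dots,0$, $1\le d_i\le m-1$, $d_i\mid d_{i+1}$, $d_i\mid m$. Stabilizing index: $s(\mathcal{A})=|\{D=\mathrm{diag}(d_1,\dots,d_n)\text{ invertible}: \mathcal{A}=D^{-(m-1)}\mathcal{A}D,\ d_1=1\}|$, where $D^{-(m-1)}\mathcal{A}D$ has entries $d_{i_1}^{-(m-1)}a_{i_1\cdots i_m}d_{i_2}\cdots d_{i_m}$. Module structure: $\mathbb{PV}_{\lambda_{\min}(\mathcal{A})}(\mathcal{A})=\mathbb{PV}_{\rho(\mathcal{B})}(\mathcal{B})$; with Perron vector $v_p>0$ of $\mathcal{B}$ (first entry $1$), representatives $y$ with $y_1=1$ satisfy $|y|=v_p$; the product $y\circ\hat y=D_yD_{\hat y}v_p$, $D_y=\mathrm{diag}(y_i/|y_i|)$, makes it an abelian group in which every element has order dividing $m$, hence a $\mathbb{Z}_m$-module.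
   Formalization: The dimension is assumed to be n ≥ 2 (and the order m ≥ 2): for n = 1 the incidence matrix is zero over Z_m, so r = 0 and clause (1), 1 ≤ r ≤ n−1, fails. *)

theory Defs
  imports Complex_Main "HOL-Algebra.Algebra"
begin

text \<open>A real tensor of order m and dimension n is a function A :: nat list => real,
  the entry a_{i_1 ... i_m} being A [i_1,...,i_m] (indices 0-based, i.e. in {0..<n}).
  Only index lists in tidx m n matter.  Vectors are functions nat => complex
  (or real) that vanish outside {0..<n}.\<close>

definition tidx :: "nat \<Rightarrow> nat \<Rightarrow> nat list set" where
  "tidx k n = {is. length is = k \<and> set is \<subseteq> {..<n}}"

text \<open>(A x^{m-1})_i\<close>
definition tapply :: "(nat list \<Rightarrow> real) \<Rightarrow> nat \<Rightarrow> nat \<Rightarrow> (nat \<Rightarrow> complex) \<Rightarrow> nat \<Rightarrow> complex" where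
  "tapply A m n x i = (\<Sum>is\<in>tidx (m - 1) n. complex_of_real (A (i # is)) * prod_list (map x is))"

text \<open>lambda is an eigenvalue of A with eigenvector x (x nonzero, supported on {0..<n}).\<close>
definition is_eigenpair :: "(nat list \<Rightarrow> real) \<Rightarrow> nat \<Rightarrow> nat \<Rightarrow> complex \<Rightarrow> (nat \<Rightarrow> complex) \<Rightarrow> bool" where
  "is_eigenpair A m n lam x \<longleftrightarrow>
     (\<forall>i\<ge>n. x i = 0) \<and> (\<exists>i<n. x i \<noteq> 0) \<and>
     (\<forall>i<n. tapply A m n x i = lam * x i ^ (m - 1))"

text \<open>least eigenvalue having a real eigenvector\<close>
definition lambda_min :: "(nat list \<Rightarrow> real) \<Rightarrow> nat \<Rightarrow> nat \<Rightarrow> real" where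
  "lambda_min A m n = (LEAST lam::real. \<exists>x::nat \<Rightarrow> real.
      is_eigenpair A m n (complex_of_real lam) (\<lambda>i. complex_of_real (x i)))"

text \<open>PV_lambda(A): the set of points of complex projective space P^{n-1} (each point
  represented as the set of all nonzero scalar multiples of a vector) that are
  eigenvectors of A for lambda.\<close>
definition PV :: "(nat list \<Rightarrow> real) \<Rightarrow> nat \<Rightarrow> nat \<Rightarrow> complex \<Rightarrow> (nat \<Rightarrow> complex) set set" where
  "PV A m n lam = {{(\<lambda>i. c * x i) | c. c \<noteq> 0} | x. is_eigenpair A m n lam x}"

definition z_tensor :: "(nat list \<Rightarrow> real) \<Rightarrow> nat \<Rightarrow> nat \<Rightarrow> bool" where
  "z_tensor A m n \<longleftrightarrow> (\<forall>is\<in>tidx m n. (\<exists>j\<in>set is. j \<noteq> hd is) \<longrightarrow> A is \<le> 0)"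

definition wi_arc :: "(nat list \<Rightarrow> real) \<Rightarrow> nat \<Rightarrow> nat \<Rightarrow> (nat \<times> nat) set" where
  "wi_arc A m n = {(i, j). i < n \<and> j < n \<and> j \<noteq> i \<and>
      (\<exists>is\<in>tidx (m - 1) n. A (i # is) \<noteq> 0 \<and> j \<in> set is)}"

definition weakly_irreducible :: "(nat list \<Rightarrow> real) \<Rightarrow> nat \<Rightarrow> nat \<Rightarrow> bool" where
  "weakly_irreducible A m n \<longleftrightarrow> (\<forall>i<n. \<forall>j<n. (i, j) \<in> (wi_arc A m n)\<^sup>*)"

text \<open>support invariant under permutations of the indices\<close>
definition comb_symmetric :: "(nat list \<Rightarrow> real) \<Rightarrow> nat \<Rightarrow> nat \<Rightarrow> bool" where
  "comb_symmetric A m n \<longleftrightarrow>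
     (\<forall>xs\<in>tidx m n. \<forall>ys\<in>tidx m n. mset xs = mset ys \<longrightarrow> (A xs \<noteq> 0 \<longleftrightarrow> A ys \<noteq> 0))"

text \<open>E(A) and the incidence matrix B_A (rows indexed by E(A), columns by {0..<n})\<close>
definition edges :: "(nat list \<Rightarrow> real) \<Rightarrow> nat \<Rightarrow> nat \<Rightarrow> nat list set" where
  "edges A m n = {is\<in>tidx m n. sorted is \<and> A is \<noteq> 0}"

definition incidence :: "nat list \<Rightarrow> nat \<Rightarrow> int" where
  "incidence e j = int (count_list e j)"

definition cong_Zm :: "int \<Rightarrow> int \<Rightarrow> nat \<Rightarrow> bool" where
  "cong_Zm a b m \<longleftrightarrow> a mod int m = b mod int m"

text \<open>B_A, regarded over Z_m, has Smith normal form over Z_m with nonzero diagonal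
  entries d 0, ..., d (r-1): there are P (|E| x |E|, columns indexed by E(A)) and
  Q (n x n), invertible over Z_m, such that P B_A Q is (mod m) the |E| x n diagonal
  matrix diag(d 0, ..., d (r-1), 0, ..., 0).\<close>
definition snf_Zm :: "(nat list \<Rightarrow> real) \<Rightarrow> nat \<Rightarrow> nat \<Rightarrow> nat \<Rightarrow> (nat \<Rightarrow> nat) \<Rightarrow> bool" where
  "snf_Zm A m n r d \<longleftrightarrow>
     (let E = edges A m n; N = card E in
       r \<le> N \<and> r \<le> n \<and>
       (\<forall>i<r. 1 \<le> d i \<and> d i \<le> m - 1 \<and> d i dvd m) \<and>
       (\<forall>i. Suc i < r \<longrightarrow> d i dvd d (Suc i)) \<and>
       (\<exists>(P :: nat \<Rightarrow> nat list \<Rightarrow> int) (P' :: nat list \<Rightarrow> nat \<Rightarrow> int)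
          (Q :: nat \<Rightarrow> nat \<Rightarrow> int) (Q' :: nat \<Rightarrow> nat \<Rightarrow> int).
          (\<forall>k<N. \<forall>k'<N. cong_Zm (\<Sum>e\<in>E. P k e * P' e k') (if k = k' then 1 else 0) m) \<and>
          (\<forall>e\<in>E. \<forall>e'\<in>E. cong_Zm (\<Sum>k<N. P' e k * P k e') (if e = e' then 1 else 0) m) \<and>
          (\<forall>i<n. \<forall>j<n. cong_Zm (\<Sum>k<n. Q i k * Q' k j) (if i = j then 1 else 0) m) \<and>
          (\<forall>i<n. \<forall>j<n. cong_Zm (\<Sum>k<n. Q' i k * Q k j) (if i = j then 1 else 0) m) \<and>
          (\<forall>k<N. \<forall>j<n.
             cong_Zm (\<Sum>e\<in>E. \<Sum>l<n. P k e * incidence e l * Q l j)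
                (if k = j \<and> k < r then int (d k) else 0) m)))"

text \<open>stabilizing index s(A)\<close>
definition stab_index :: "(nat list \<Rightarrow> real) \<Rightarrow> nat \<Rightarrow> nat \<Rightarrow> nat" where
  "stab_index A m n = card {D :: nat \<Rightarrow> complex.
      (\<forall>i<n. D i \<noteq> 0) \<and> (\<forall>i\<ge>n. D i = 0) \<and> D 0 = 1 \<and>
      (\<forall>is\<in>tidx m n. complex_of_real (A is) =
          inverse (D (hd is)) ^ (m - 1) * complex_of_real (A is) * prod_list (map D (tl is)))}"

text \<open>Perron vector v_p of B (where A = sI - B): the positive eigenvector with first
  entry 1 (a vector is an eigenvector of B iff it is one of A).\<close>
definition perron_vec :: "(nat list \<Rightarrow> real) \<Rightarrow> nat \<Rightarrow> nat \<Rightarrow> nat \<Rightarrow> real" where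
  "perron_vec A m n = (THE v. (\<forall>i<n. v i > 0) \<and> (\<forall>i\<ge>n. v i = 0) \<and> v 0 = 1 \<and>
      (\<exists>lam::real. is_eigenpair A m n (complex_of_real lam) (\<lambda>i. complex_of_real (v i))))"

text \<open>The group structure on PV_{lambda_min}(A): elements are the representatives y
  with y_1 = 1, product y o y' = D_y D_{y'} v_p with D_y = diag(y_i/|y_i|),
  identity v_p.\<close>
definition PV_group :: "(nat list \<Rightarrow> real) \<Rightarrow> nat \<Rightarrow> nat \<Rightarrow> (nat \<Rightarrow> complex) monoid" where
  "PV_group A m n =
     \<lparr>carrier = {y. is_eigenpair A m n (complex_of_real (lambda_min A m n)) y \<and> y 0 = 1},
      monoid.mult = (\<lambda>y y' i. if i < n then sgn (y i) * sgn (y' i) * complex_of_real (perron_vec A m n i) else 0),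
      monoid.one = (\<lambda>i. complex_of_real (perron_vec A m n i))\<rparr>"

text \<open>The moduli of the decomposition: Z_{d_i} for d_i \<noteq> 1, then (n-1-r) copies of Z_m\<close>
definition snf_moduli :: "nat \<Rightarrow> nat \<Rightarrow> nat \<Rightarrow> (nat \<Rightarrow> nat) \<Rightarrow> nat list" where
  "snf_moduli m n r d = filter (\<lambda>k. k \<noteq> 1) (map d [0..<r]) @ replicate (n - 1 - r) m"

definition decomp_group :: "nat list \<Rightarrow> (nat \<Rightarrow> int) monoid" where
  "decomp_group L = product_group {..<length L} (\<lambda>j. integer_mod_group (L ! j))"

end

theory Submission
  imports Defs "HOL-Analysis.Analysis" "HOL-Library.Real_Mod" "HOL-Number_Theory.Cong"
begin

text \<open>
  Write \<open>A = s I - B\<close> with \<open>B \<ge> 0\<close>. Combinatorial symmetry bounds the ratios \<open>x j / x i\<close> for all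
  positive \<open>x\<close> with \<open>B x\<^sup>m\<^sup>-\<^sup>1 \<le> R x\<^sup>[\<^sup>m\<^sup>-\<^sup>1\<^sup>]\<close>, so the Collatz--Wielandt minimum is attained, and by
  weak irreducibility a minimiser is a positive eigenvector \<open>v\<close>. Comparing \<open>|y|\<close> with \<open>v\<close>, the
  eigenvectors \<open>y\<close> of the least eigenvalue with \<open>y 0 = 1\<close> are exactly the vectors \<open>D v\<close> with \<open>D\<close> a
  diagonal matrix stabilising \<open>A\<close>. The entries of such a \<open>D\<close> are \<open>m\<close>-th roots of unity, whose exponents
  form the part \<open>x 0 = 0\<close> of the kernel of the incidence matrix over \<open>\<int>\<^sub>m\<close>. This kernel contains
  \<open>(1, \<dots>, 1)\<close>; the Smith normal form makes it a sum of the groups \<open>\<int>\<^bsub>d i\<^esub>\<close> and of \<open>n - r\<close> copies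
  of \<open>\<int>\<^sub>m\<close>, and one copy of \<open>\<int>\<^sub>m\<close> has to be cancelled.
\<close>

section \<open>Perron--Frobenius theory\<close>

text \<open>Two obstacles shape the proof. The positive cone is not compact, so attaining the
  minimum needs a priori bounds; symmetry supplies them because any index of an edge may head a row
  carrying that edge. The shift \<open>s\<close> is explicit, and moving the diagonal is harmless: a
  diagonal entry imposes only \<open>D i ^ (m - 1) = D i ^ (m - 1)\<close>. The second obstacle is
  that the normalisation \<open>x 0 = 0\<close> concerns an original coordinate, while the Smith
  form speaks about the coordinates \<open>q x\<close>, the inverse of \<open>Q\<close> applied to
  \<open>x\<close>. The cancellation is made explicit by a kernel vector \<open>v\<close> on which
  both \<open>x 0\<close> and \<open>q x r\<close> are units; projecting along \<open>v\<close>
  carries one hyperplane to the other. Index \<open>r\<close> is available because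
  \<open>r < n\<close>: for \<open>r = n\<close> the multiple \<open>d (n - 1)\<close> of the
  all-ones vector would vanish modulo \<open>m\<close>, although \<open>d (n - 1)\<close> is at most
  \<open>m - 1\<close>. Residues are handled through integer lifts, with congruence modulo
  \<open>m\<close> in the role of equality.\<close>

lemma finite_tidx [simp]: "finite (tidx k n)"
proof -
  have "tidx k n = {is. set is \<subseteq> {..<n} \<and> length is = k}"
    by (auto simp: tidx_def)
  then show ?thesis
    using finite_lists_length_eq[of "{..<n}" k] by simp
qed

lemma Cons_in_tidx: "k \<ge> 1 \<Longrightarrow> i # is \<in> tidx k n \<longleftrightarrow> i < n \<and> is \<in> tidx (k - 1) n"
  by (auto simp: tidx_def)

lemma tidxD: "is \<in> tidx k n \<Longrightarrow> j \<in> set is \<Longrightarrow> j < n"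
  by (auto simp: tidx_def)

lemma prod_list_map_mono:
  fixes x y :: "'a \<Rightarrow> real"
  assumes "\<And>i. i \<in> set xs \<Longrightarrow> 0 \<le> x i" "\<And>i. i \<in> set xs \<Longrightarrow> x i \<le> y i"
  shows "prod_list (map x xs) \<le> prod_list (map y xs)"
  using assms
proof (induction xs)
  case (Cons a xs)
  then have "x a * prod_list (map x xs) \<le> y a * prod_list (map y xs)"
    by (intro mult_mono) (auto intro!: prod_list_nonneg order_trans[OF Cons.prems])
  then show ?case by simp
qed simp

lemma prod_list_map_pos:
  fixes x :: "'a \<Rightarrow> real"
  assumes "\<And>i. i \<in> set xs \<Longrightarrow> 0 < x i"
  shows "0 < prod_list (map x xs)"
  using assms by (induction xs) auto

text \<open>The positive upper product can be cancelled one factor at a time. This rigidity is what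
  carries equality in a row across the arcs leaving it.\<close>

lemma prod_list_map_eq_imp_eq:
  fixes x y :: "'a \<Rightarrow> real"
  assumes "\<And>i. i \<in> set xs \<Longrightarrow> 0 \<le> x i" "\<And>i. i \<in> set xs \<Longrightarrow> x i \<le> y i"
    and "\<And>i. i \<in> set xs \<Longrightarrow> 0 < y i"
    and "prod_list (map x xs) = prod_list (map y xs)" "j \<in> set xs"
  shows "x j = y j"
  using assms
proof (induction xs)
  case (Cons a xs)
  let ?X = "prod_list (map x xs)" and ?Y = "prod_list (map y xs)"
  have le: "?X \<le> ?Y" using Cons.prems by (intro prod_list_map_mono) auto
  have Y: "0 < ?Y" using Cons.prems by (intro prod_list_map_pos) auto
  have a: "0 \<le> x a" "x a \<le> y a" "0 < y a" using Cons.prems by auto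
  have eq: "x a * ?X = y a * ?Y" using Cons.prems by simp
  have "x a * ?X \<le> x a * ?Y" using le a by (simp add: mult_left_mono)
  then have "y a * ?Y \<le> x a * ?Y" using eq by simp
  then have xa: "x a = y a" using Y a by simp
  with eq a have "?X = ?Y" by simp
  with Cons xa show ?case by auto
qed simp

lemma prod_list_map_mult:
  fixes x y :: "'a \<Rightarrow> 'b::comm_monoid_mult"
  shows "prod_list (map (\<lambda>i. x i * y i) xs) = prod_list (map x xs) * prod_list (map y xs)"
  by (induction xs) (auto simp: mult_ac)

lemma prod_list_map_const: "prod_list (map (\<lambda>i. c) xs) = (c :: 'b::comm_monoid_mult) ^ length xs"
  by (induction xs) auto

text \<open>The real counterpart of \<open>tapply\<close>, kept separate so that order and
  continuity arguments stay in the reals.\<close>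

definition rapply :: "(nat list \<Rightarrow> real) \<Rightarrow> nat \<Rightarrow> nat \<Rightarrow> (nat \<Rightarrow> real) \<Rightarrow> nat \<Rightarrow> real" where
  "rapply b m n x i = (\<Sum>is\<in>tidx (m - 1) n. b (i # is) * prod_list (map x is))"

lemma of_real_prod_list_map:
  "complex_of_real (prod_list (map x xs)) = prod_list (map (\<lambda>i. complex_of_real (x i)) xs)"
  by (induction xs) auto

lemma tapply_of_real:
  "tapply b m n (\<lambda>i. complex_of_real (x i)) i = complex_of_real (rapply b m n x i)"
  by (simp add: tapply_def rapply_def of_real_prod_list_map)

lemma rapply_cong:
  assumes "\<And>j. j < n \<Longrightarrow> x j = y j"
  shows "rapply b m n x i = rapply b m n y i"
  unfolding rapply_def
proof (intro sum.cong refl)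
  fix "is" assume "is \<in> tidx (m - 1) n"
  then have "map x is = map y is"
    using assms by (auto dest: tidxD)
  then show "b (i # is) * prod_list (map x is) = b (i # is) * prod_list (map y is)"
    by (simp only:)
qed

lemma rapply_scale: "rapply b m n (\<lambda>i. c * x i) i = c ^ (m - 1) * rapply b m n x i"
proof -
  have "rapply b m n (\<lambda>i. c * x i) i
      = (\<Sum>is\<in>tidx (m - 1) n. c ^ (m - 1) * (b (i # is) * prod_list (map x is)))"
    unfolding rapply_def
    by (intro sum.cong refl) (auto simp: prod_list_map_mult prod_list_map_const tidx_def)
  then show ?thesis
    by (simp add: rapply_def sum_distrib_left)
qed

lemma continuous_on_prod_list_map:
  fixes f :: "'a::topological_space \<Rightarrow> 'b \<Rightarrow> real"
  assumes "\<And>i. continuous_on S (\<lambda>x. f x i)"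
  shows "continuous_on S (\<lambda>x. prod_list (map (f x) xs))"
  by (induction xs) (auto intro!: continuous_intros assms)

lemma continuous_on_rapply:
  fixes f :: "'a::topological_space \<Rightarrow> nat \<Rightarrow> real"
  assumes "\<And>j. continuous_on S (\<lambda>x. f x j)"
  shows "continuous_on S (\<lambda>x. rapply b m n (f x) i)"
  unfolding rapply_def by (intro continuous_intros continuous_on_prod_list_map assms)

text \<open>Tychonoff in the product topology on functions: vectors of variable length
  \<open>n\<close> become compactly confined once the coordinates outside the index range are pinned
  to 0.\<close>

lemma compact_box_fun:
  fixes l u :: "'a \<Rightarrow> real"
  shows "compact {x. \<forall>i. l i \<le> x i \<and> x i \<le> u i}"
proof -
  have "compactin (product_topology (\<lambda>i. euclidean) UNIV) (PiE UNIV (\<lambda>i. {l i..u i}))"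
    by (simp add: compactin_PiE)
  then have "compact (PiE UNIV (\<lambda>i. {l i..u i}))"
    by (simp add: euclidean_product_topology)
  moreover have "PiE UNIV (\<lambda>i. {l i..u i}) = {x. \<forall>i. l i \<le> x i \<and> x i \<le> u i}"
    by (auto simp: PiE_iff)
  ultimately show ?thesis by simp
qed

section \<open>Nonnegative tensors: comparison with a positive eigenvector\<close>

locale nonneg_tensor =
  fixes b :: "nat list \<Rightarrow> real" and m n :: nat
  assumes m2: "m \<ge> 2" and n2: "n \<ge> 2"
    and nonneg: "\<And>is. is \<in> tidx m n \<Longrightarrow> 0 \<le> b is"
    and sym: "comb_symmetric b m n" and conn: "weakly_irreducible b m n"
begin

abbreviation "ap \<equiv> rapply b m n"

lemma Cons_tidx: "i < n \<Longrightarrow> is \<in> tidx (m - 1) n \<Longrightarrow> i # is \<in> tidx m n"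
  using m2 by (simp add: Cons_in_tidx)

lemma nonneg_Cons: "i < n \<Longrightarrow> is \<in> tidx (m - 1) n \<Longrightarrow> 0 \<le> b (i # is)"
  using nonneg Cons_tidx by blast

lemma term_le_ap:
  assumes "i < n" "is \<in> tidx (m - 1) n" "\<And>j. j < n \<Longrightarrow> 0 \<le> x j"
  shows "b (i # is) * prod_list (map x is) \<le> ap x i"
  unfolding rapply_def
proof (rule member_le_sum[where f = "\<lambda>is. b (i # is) * prod_list (map x is)"])
  fix xs assume "xs \<in> tidx (m - 1) n - {is}"
  then show "0 \<le> b (i # xs) * prod_list (map x xs)"
    using assms tidxD[of xs "m - 1" n]
    by (auto intro!: mult_nonneg_nonneg nonneg_Cons prod_list_nonneg)
qed (use assms in simp_all)

lemma ap_nonneg: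
  assumes "i < n" "\<And>j. j < n \<Longrightarrow> 0 \<le> x j"
  shows "0 \<le> ap x i"
  unfolding rapply_def
proof (rule sum_nonneg)
  fix xs assume "xs \<in> tidx (m - 1) n"
  then show "0 \<le> b (i # xs) * prod_list (map x xs)"
    using assms tidxD[of xs "m - 1" n]
    by (auto intro!: mult_nonneg_nonneg nonneg_Cons prod_list_nonneg)
qed

lemma ap_mono:
  assumes "i < n" "\<And>j. j < n \<Longrightarrow> 0 \<le> x j" "\<And>j. j < n \<Longrightarrow> x j \<le> y j"
  shows "ap x i \<le> ap y i"
  unfolding rapply_def
  using assms
  by (intro sum_mono mult_left_mono prod_list_map_mono nonneg_Cons) (auto simp: tidx_def)

lemma ap_eq_imp_eq:
  assumes "i < n" "\<And>j. j < n \<Longrightarrow> 0 \<le> x j" "\<And>j. j < n \<Longrightarrow> x j \<le> y j"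
    and "\<And>j. j < n \<Longrightarrow> 0 < y j" and "ap x i = ap y i" and "(i, j) \<in> wi_arc b m n"
  shows "x j = y j"
proof -
  obtain xs where xs: "xs \<in> tidx (m - 1) n" "b (i # xs) \<noteq> 0" "j \<in> set xs"
    using assms(6) by (auto simp: wi_arc_def)
  have "b (i # xs) * prod_list (map x xs) = b (i # xs) * prod_list (map y xs)"
  proof (rule sum_mono_inv[where I = "tidx (m - 1) n"
          and f = "\<lambda>is. b (i # is) * prod_list (map x is)"
          and g = "\<lambda>is. b (i # is) * prod_list (map y is)"])
    show "(\<Sum>is\<in>tidx (m - 1) n. b (i # is) * prod_list (map x is)) =
          (\<Sum>is\<in>tidx (m - 1) n. b (i # is) * prod_list (map y is))"
      using assms(5) by (simp add: rapply_def)
    show "b (i # is) * prod_list (map x is) \<le> b (i # is) * prod_list (map y is)"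
      if "is \<in> tidx (m - 1) n" for "is"
      using assms that
      by (intro mult_left_mono prod_list_map_mono nonneg_Cons) (auto simp: tidx_def)
  qed (use xs in auto)
  then have "prod_list (map x xs) = prod_list (map y xs)"
    using xs by simp
  moreover have "\<And>i. i \<in> set xs \<Longrightarrow> i < n" using xs by (auto simp: tidx_def)
  ultimately show ?thesis
    using assms xs(3) by (intro prod_list_map_eq_imp_eq[of xs x y j]) auto
qed

text \<open>A path from a vertex outside \<open>S\<close> to one inside must enter \<open>S\<close>
  somewhere. Applied to a complement, it yields an arc leaving a set.\<close>

lemma arc_crossing:
  assumes "S \<subseteq> {..<n}" "S \<noteq> {}" "S \<noteq> {..<n}"
  obtains i j where "(i, j) \<in> wi_arc b m n" "i \<notin> S" "j \<in> S"
proof -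
  obtain i0 where i0: "i0 < n" "i0 \<notin> S" using assms by auto
  obtain j0 where j0: "j0 \<in> S" using assms by auto
  have "(i0, j0) \<in> (wi_arc b m n)\<^sup>*"
    using conn i0 j0 assms by (auto simp: weakly_irreducible_def)
  then have "j0 \<in> S \<longrightarrow> (\<exists>i j. (i, j) \<in> wi_arc b m n \<and> i \<notin> S \<and> j \<in> S)"
  proof (induction rule: rtrancl_induct)
    case base then show ?case using i0 by simp
  next
    case (step y z) then show ?case by blast
  qed
  then show ?thesis using that j0 by blast
qed

text \<open>A maximum principle. Scale \<open>v\<close> by the largest ratio \<open>c\<close> so
  that \<open>c * v\<close> lies above \<open>x\<close> and touches it on a set \<open>S\<close>. A
  row in \<open>S\<close> gives the inequality of the constants; if they are equal, every arc
  leaving a vertex of \<open>S\<close> ends in \<open>S\<close>, so connectivity makes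
  \<open>S\<close> everything.\<close>

lemma comparison:
  assumes v: "\<And>i. i < n \<Longrightarrow> 0 < v i" "\<And>i. i < n \<Longrightarrow> ap v i = \<rho> * v i ^ (m - 1)"
    and x: "\<And>i. i < n \<Longrightarrow> 0 \<le> x i" "\<exists>i<n. x i \<noteq> 0"
      "\<And>i. i < n \<Longrightarrow> \<sigma> * x i ^ (m - 1) \<le> ap x i"
  shows "\<sigma> \<le> \<rho>" "\<sigma> = \<rho> \<Longrightarrow> \<exists>c>0. \<forall>i<n. x i = c * v i"
proof -
  define c where "c = Max ((\<lambda>i. x i / v i) ` {..<n})"
  have c_ge: "x i / v i \<le> c" if "i < n" for i
    unfolding c_def using that by (intro Max_ge) auto
  have le: "x i \<le> c * v i" if "i < n" for i
    using c_ge[OF that] v(1)[OF that] by (simp add: field_simps)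
  obtain k where k: "k < n" "x k \<noteq> 0" using x(2) by auto
  have "0 < x k / v k" using x(1)[OF k(1)] k v(1)[OF k(1)] by simp
  then have cpos: "0 < c" using c_ge[OF k(1)] by linarith
  define S where "S = {i. i < n \<and> x i = c * v i}"
  have "c \<in> (\<lambda>i. x i / v i) ` {..<n}"
    unfolding c_def using n2 by (intro Max_in) (auto simp: lessThan_empty_iff)
  then obtain i0 where "i0 < n" "c = x i0 / v i0" by auto
  then have i0: "i0 < n" "i0 \<in> S" using v(1)[of i0] by (auto simp: S_def)
  have ub: "ap (\<lambda>i. c * v i) i = \<rho> * x i ^ (m - 1)" if "i \<in> S" for i
    using that v(2)[of i] by (simp add: rapply_scale S_def power_mult_distrib)
  have apx: "ap x i \<le> ap (\<lambda>i. c * v i) i" if "i < n" for i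
    using that x le by (intro ap_mono) auto
  have "\<sigma> * x i0 ^ (m - 1) \<le> \<rho> * x i0 ^ (m - 1)"
    using x(3)[OF i0(1)] apx[OF i0(1)] ub[OF i0(2)] by linarith
  moreover have "0 < x i0" using i0 cpos v(1) by (simp add: S_def)
  ultimately show "\<sigma> \<le> \<rho>" by simp
  assume eq: "\<sigma> = \<rho>"
  have "S = {..<n}"
  proof (rule ccontr)
    assume "S \<noteq> {..<n}"
    moreover have "{..<n} - S \<subseteq> {..<n}" by auto
    moreover have "{..<n} - S \<noteq> {..<n}" using i0 by auto
    moreover have "S \<subseteq> {..<n}" by (auto simp: S_def)
    ultimately obtain i j where ij: "(i, j) \<in> wi_arc b m n" "i \<notin> {..<n} - S" "j \<in> {..<n} - S"
      using arc_crossing[of "{..<n} - S"] by blast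
    then have i: "i < n" "i \<in> S" by (auto simp: wi_arc_def)
    \<comment> \<open>Row \<open>i\<close> is squeezed: \<open>ap x i\<close> lies between
      \<open>\<sigma> * x i ^ (m - 1)\<close> and \<open>\<rho> * x i ^ (m - 1)\<close>, which now
      coincide.\<close>
    have "ap x i = ap (\<lambda>i. c * v i) i"
      using x(3)[OF i(1)] apx[OF i(1)] ub[OF i(2)] unfolding eq by linarith
    then have "x j = c * v j"
      using ap_eq_imp_eq[of i x "\<lambda>i. c * v i" j] i x(1) le cpos v(1) ij(1) by simp
    then show False using ij by (auto simp: S_def)
  qed
  then show "\<exists>c>0. \<forall>i<n. x i = c * v i"
    using cpos by (auto simp: S_def)
qed

section \<open>Existence of the positive eigenvector\<close>

text \<open>By combinatorial symmetry every index of an edge may head its row; the row of the index where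
  \<open>x\<close> is smallest bounds all other entries on that edge.\<close>

lemma arc_ratio_bound:
  assumes "(i, j) \<in> wi_arc b m n"
  obtains C where "C > 0" "\<And>x. \<lbrakk>\<And>k. k < n \<Longrightarrow> 0 < x k; \<And>k. k < n \<Longrightarrow> ap x k \<le> R * x k ^ (m - 1)\<rbrakk>
    \<Longrightarrow> x j \<le> C * x i"
proof -
  obtain xs where xs0: "xs \<in> tidx (m - 1) n" "b (i # xs) \<noteq> 0" "j \<in> set xs" "i < n"
    using assms by (auto simp: wi_arc_def)
  define es where "es = i # xs"
  have es: "es \<in> tidx m n" "b es \<noteq> 0" "j \<in> set es" "i \<in> set es"
    using xs0 Cons_tidx by (auto simp: es_def)
  have bp: "0 < b (p # remove1 p es)" "remove1 p es \<in> tidx (m - 1) n" "p < n"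
    if p: "p \<in> set es" for p
  proof -
    show 1: "remove1 p es \<in> tidx (m - 1) n" "p < n"
      using es(1) p set_remove1_subset[of p es] by (auto simp: tidx_def length_remove1)
    then have "p # remove1 p es \<in> tidx m n" by (simp add: Cons_tidx)
    moreover have "mset (p # remove1 p es) = mset es" using p by simp
    ultimately show "0 < b (p # remove1 p es)"
      using es(1,2) sym nonneg[of "p # remove1 p es"] unfolding comb_symmetric_def
      by (metis less_le)
  qed
  \<comment> \<open>The index \<open>p\<close> of the smallest entry depends on \<open>x\<close>, so
    the constant sums over all candidates \<open>p\<close>. The summand 1 gives
    \<open>1 \<le> C\<close>, which settles \<open>j = p\<close> and allows \<open>x p\<close> to be
    replaced by \<open>x i\<close> at the end.\<close>
  define C where "C = 1 + (\<Sum>p\<in>set es. \<bar>R\<bar> / b (p # remove1 p es))"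
  have Cge: "\<bar>R\<bar> / b (p # remove1 p es) \<le> C" if "p \<in> set es" for p
    unfolding C_def using that bp
    by (intro order_trans[OF member_le_sum[of p "set es" "\<lambda>p. \<bar>R\<bar> / b (p # remove1 p es)"]])
      (auto simp: less_imp_le)
  have C1: "1 \<le> C"
    unfolding C_def using bp by (simp add: sum_nonneg less_imp_le)
  show ?thesis
  proof (rule that)
    show "C > 0" using C1 by simp
    fix x assume x: "\<And>k. k < n \<Longrightarrow> 0 < x k" "\<And>k. k < n \<Longrightarrow> ap x k \<le> R * x k ^ (m - 1)"
    obtain p where p: "p \<in> set es" "\<And>q. q \<in> set es \<Longrightarrow> x p \<le> x q"
      using ex_is_arg_min_if_finite[of "set es" x] es(3)
      by (metis empty_iff finite_set is_arg_min_linorder)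
    let ?ys = "remove1 p es"
    have xp: "0 < x p" using x(1) bp[OF p(1)] by simp
    have "x j \<le> C * x p"
    proof (cases "j = p")
      case True
      then show ?thesis using C1 xp by simp
    next
      case False
      then have j: "j \<in> set ?ys" using es(3) by simp
      \<comment> \<open>Isolate one occurrence of \<open>j\<close>. The other \<open>m - 2\<close>
        factors are at least \<open>x p\<close>, so the row of \<open>p\<close> bounds
        \<open>x j * x p ^ (m - 2)\<close> by a multiple of \<open>x p ^ (m - 1)\<close>, and the
        power cancels.\<close>
      then obtain ys1 ys2 where ys: "?ys = ys1 @ j # ys2" by (meson split_list)
      have len: "length ys1 + length ys2 = m - 2"
        using bp(2)[OF p(1)] ys m2 by (auto simp: tidx_def)
      have ge: "x p \<le> x q" if "q \<in> set ?ys" for q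
        using p(2) that notin_set_remove1 by metis
      have "x p ^ length ys1 \<le> prod_list (map x ys1)"
        using prod_list_map_mono[of ys1 "\<lambda>_. x p" x] ge xp ys by (simp add: prod_list_map_const)
      moreover have "x p ^ length ys2 \<le> prod_list (map x ys2)"
        using prod_list_map_mono[of ys2 "\<lambda>_. x p" x] ge xp ys by (simp add: prod_list_map_const)
      moreover have xj: "0 < x j" using xp ge[OF j] by simp
      ultimately have "x p ^ length ys1 * (x j * x p ^ length ys2) \<le> prod_list (map x ?ys)"
        unfolding ys using xp
        by (auto intro!: mult_mono intro: order_trans[of 0 "x p ^ length ys1"])
      then have "x j * x p ^ (m - 2) \<le> prod_list (map x ?ys)"
        by (simp add: len[symmetric] power_add mult_ac)
      then have "b (p # ?ys) * (x j * x p ^ (m - 2)) \<le> b (p # ?ys) * prod_list (map x ?ys)"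
        using bp(1)[OF p(1)] by simp
      also have "\<dots> \<le> ap x p"
        using bp[OF p(1)] x(1) by (intro term_le_ap) (auto simp: less_imp_le)
      also have "\<dots> \<le> R * x p ^ (m - 1)" using x(2) bp(3)[OF p(1)] by simp
      also have "\<dots> \<le> \<bar>R\<bar> * x p ^ (m - 1)" using xp by (simp add: mult_right_mono)
      also have "m - 1 = Suc (m - 2)" using m2 by simp
      finally have "(b (p # ?ys) * x j) * x p ^ (m - 2) \<le> (\<bar>R\<bar> * x p) * x p ^ (m - 2)"
        by (simp add: mult_ac)
      then have "b (p # ?ys) * x j \<le> \<bar>R\<bar> * x p" using xp by simp
      then have "x j \<le> \<bar>R\<bar> / b (p # ?ys) * x p"
        using bp(1)[OF p(1)] by (simp add: field_simps)
      also have "\<dots> \<le> C * x p" using Cge[OF p(1)] xp by (intro mult_right_mono) auto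
      finally show ?thesis .
    qed
    also have "\<dots> \<le> C * x i" using p(2)[OF es(4)] C1 by simp
    finally show "x j \<le> C * x i" .
  qed
qed

text \<open>The arc constants multiply along a path. They depend on \<open>R\<close> but not on
  \<open>x\<close>, which is what compactness requires.\<close>

lemma ratio_bound:
  assumes "i < n" "j < n"
  shows "\<exists>C>0. \<forall>x. (\<forall>k<n. 0 < x k) \<longrightarrow> (\<forall>k<n. ap x k \<le> R * x k ^ (m - 1)) \<longrightarrow> x j \<le> C * x i"
proof -
  have "(i, j) \<in> (wi_arc b m n)\<^sup>*"
    using conn assms by (auto simp: weakly_irreducible_def)
  then show ?thesis
  proof (induction rule: rtrancl_induct)
    case base
    then show ?case by (intro exI[of _ 1]) auto
  next
    case (step j k)
    obtain C where C: "C > 0" "\<forall>x. (\<forall>k<n. 0 < x k) \<longrightarrow> (\<forall>k<n. ap x k \<le> R * x k ^ (m - 1)) \<longrightarrow> x j \<le> C * x i"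
      using step.IH by blast
    obtain C' where C': "C' > 0" "\<And>x. \<lbrakk>\<And>k. k < n \<Longrightarrow> 0 < x k; \<And>k. k < n \<Longrightarrow> ap x k \<le> R * x k ^ (m - 1)\<rbrakk>
        \<Longrightarrow> x k \<le> C' * x j"
      using arc_ratio_bound[OF step.hyps(2)] by metis
    show ?case
    proof (intro exI[of _ "C' * C"] conjI allI impI)
      fix x assume x: "\<forall>k<n. 0 < x k" "\<forall>k<n. ap x k \<le> R * x k ^ (m - 1)"
      have "x k \<le> C' * x j" using C'(2) x by blast
      also have "\<dots> \<le> C' * (C * x i)" using C x C' by simp
      finally show "x k \<le> C' * C * x i" by (simp add: mult_ac)
    qed (use C C' in simp)
  qed
qed

text \<open>After normalising \<open>x 0 = 1\<close>, the ratio bounds confine all candidates to a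
  box whose lower bounds are positive on the index range. The pairs of a constant and a vector then
  form a compact set, on which the first component attains its minimum at a vector that is still
  positive.\<close>

lemma minimal_supersolution:
  obtains \<rho> v where "\<And>i. i < n \<Longrightarrow> 0 < v i" "\<And>i. i < n \<Longrightarrow> ap v i \<le> \<rho> * v i ^ (m - 1)"
    "\<And>x \<sigma>. \<lbrakk>\<And>i. i < n \<Longrightarrow> 0 < x i; \<And>i. i < n \<Longrightarrow> ap x i \<le> \<sigma> * x i ^ (m - 1)\<rbrakk> \<Longrightarrow> \<rho> \<le> \<sigma>"
proof -
  \<comment> \<open>The sum of all row sums dominates each of them, so the all-ones vector is
    admissible with constant \<open>R\<close> and only constants up to \<open>R\<close> have to be
    searched.\<close>
  define R where "R = (\<Sum>i<n. ap (\<lambda>_. 1) i)"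
  define adm where "adm x \<longleftrightarrow> (\<forall>k<n. 0 < x k) \<and> (\<forall>k<n. ap x k \<le> R * x k ^ (m - 1))" for x
  have "\<forall>j. \<exists>C. j < n \<longrightarrow> C > 0 \<and> (\<forall>x. adm x \<longrightarrow> x j \<le> C * x 0)"
  proof
    fix j
    show "\<exists>C. j < n \<longrightarrow> C > 0 \<and> (\<forall>x. adm x \<longrightarrow> x j \<le> C * x 0)"
      using ratio_bound[of 0 j R] n2 unfolding adm_def by (cases "j < n") auto
  qed
  then obtain U where "\<forall>j<n. U j > 0 \<and> (\<forall>x. adm x \<longrightarrow> x j \<le> U j * x 0)"
    unfolding choice_iff by blast
  then have U: "\<And>j. j < n \<Longrightarrow> U j > 0" "\<And>j x. j < n \<Longrightarrow> adm x \<Longrightarrow> x j \<le> U j * x 0"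
    by auto
  have "\<forall>j. \<exists>C. j < n \<longrightarrow> C > 0 \<and> (\<forall>x. adm x \<longrightarrow> x 0 \<le> C * x j)"
  proof
    fix j
    show "\<exists>C. j < n \<longrightarrow> C > 0 \<and> (\<forall>x. adm x \<longrightarrow> x 0 \<le> C * x j)"
      using ratio_bound[of j 0 R] n2 unfolding adm_def by (cases "j < n") auto
  qed
  then obtain L where "\<forall>j<n. L j > 0 \<and> (\<forall>x. adm x \<longrightarrow> x 0 \<le> L j * x j)"
    unfolding choice_iff by blast
  then have L: "\<And>j. j < n \<Longrightarrow> L j > 0" "\<And>j x. j < n \<Longrightarrow> adm x \<Longrightarrow> x 0 \<le> L j * x j"
    by auto
  \<comment> \<open>The bounds \<open>x 0 \<le> L i * x i\<close> and
    \<open>x i \<le> U i * x 0\<close>, read at \<open>x 0 = 1\<close>, give the sides of the box;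
    outside the index range both sides are 0.\<close>
  define l where "l i = (if i < n then 1 / L i else 0)" for i
  define u where "u i = (if i < n then U i else 0)" for i
  have lpos: "0 < l i" if "i < n" for i using L(1)[OF that] that by (simp add: l_def)
  define Box :: "(nat \<Rightarrow> real) set" where "Box = {x. \<forall>i. l i \<le> x i \<and> x i \<le> u i}"
  define S :: "(real \<times> (nat \<Rightarrow> real)) set" where "S = ({0..R} \<times> Box) \<inter> {p. \<forall>i<n. ap (snd p) i \<le> fst p * snd p i ^ (m - 1)}"
  have cont: "continuous_on UNIV (\<lambda>p::real \<times> (nat \<Rightarrow> real). snd p j)" for j
    by (rule continuous_on_product_then_coordinatewise[OF continuous_on_snd[OF continuous_on_id]])
  have "closed {p. \<forall>i<n. ap (snd p) i \<le> fst p * snd p i ^ (m - 1)}"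
    by (intro closed_Collect_all closed_Collect_imp closed_Collect_le open_Collect_const
        continuous_on_rapply cont continuous_intros)
  then have "compact S"
    unfolding S_def Box_def by (intro compact_Int_closed compact_Times compact_box_fun) auto
  have R_ge: "ap (\<lambda>_. 1) i \<le> R" if "i < n" for i
    unfolding R_def using that by (intro member_le_sum ap_nonneg) auto
  have norm_in_S: "(\<sigma>, \<lambda>i. if i < n then x i / x 0 else 0) \<in> S"
    if x: "\<And>i. i < n \<Longrightarrow> 0 < x i" "\<And>i. i < n \<Longrightarrow> ap x i \<le> \<sigma> * x i ^ (m - 1)" and "\<sigma> \<le> R" for \<sigma> x
  proof -
    let ?y = "\<lambda>i. if i < n then x i / x 0 else 0"
    have x0: "0 < x 0" using x(1) n2 by simp
    have "adm x"
      unfolding adm_def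
    proof (intro conjI allI impI)
      fix k assume k: "k < n"
      have "ap x k \<le> \<sigma> * x k ^ (m - 1)" using x k by simp
      also have "\<dots> \<le> R * x k ^ (m - 1)" using x(1)[OF k] \<open>\<sigma> \<le> R\<close> by (simp add: mult_right_mono)
      finally show "ap x k \<le> R * x k ^ (m - 1)" .
    qed (use x in simp)
    have "0 \<le> ap x 0" using x(1) n2 by (intro ap_nonneg) (auto simp: less_imp_le)
    then have "0 \<le> \<sigma> * x 0 ^ (m - 1)" using x(2)[of 0] n2 by simp
    then have "0 \<le> \<sigma>" using zero_less_power[OF x0, of "m - 1"] by (auto simp: zero_le_mult_iff)
    moreover have "?y \<in> Box"
      using U(2)[OF _ \<open>adm x\<close>] L(2)[OF _ \<open>adm x\<close>] L(1) x0
      by (auto simp: Box_def l_def u_def field_simps)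
    moreover have "ap ?y i \<le> \<sigma> * ?y i ^ (m - 1)" if "i < n" for i
    proof -
      have "ap ?y i = ap (\<lambda>i. (1 / x 0) * x i) i" by (rule rapply_cong) simp
      also have "\<dots> = (1 / x 0) ^ (m - 1) * ap x i" by (rule rapply_scale)
      also have "\<dots> \<le> (1 / x 0) ^ (m - 1) * (\<sigma> * x i ^ (m - 1))"
        using x0 x(2)[OF that] by (simp add: mult_left_mono)
      finally show ?thesis using that by (simp add: power_divide)
    qed
    ultimately show ?thesis using \<open>\<sigma> \<le> R\<close> by (simp add: S_def)
  qed
  have "(R, \<lambda>i. if i < n then (1::real) / 1 else 0) \<in> S"
    using norm_in_S[of "\<lambda>_. 1" R] R_ge by simp
  then have "S \<noteq> {}" by blast
  have "continuous_on S fst" by (intro continuous_intros)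
  then obtain p where p: "p \<in> S" "\<And>q. q \<in> S \<Longrightarrow> fst p \<le> fst q"
    using continuous_attains_inf[OF \<open>compact S\<close> \<open>S \<noteq> {}\<close>] by blast
  show ?thesis
  proof (rule that[of "snd p" "fst p"])
    fix i assume "i < n"
    then show "0 < snd p i" using p(1) lpos[of i] by (auto simp: S_def Box_def intro: less_le_trans)
    show "ap (snd p) i \<le> fst p * snd p i ^ (m - 1)" using p(1) \<open>i < n\<close> by (simp add: S_def)
  next
    fix x :: "nat \<Rightarrow> real" and \<sigma> assume "\<And>i. i < n \<Longrightarrow> 0 < x i" "\<And>i. i < n \<Longrightarrow> ap x i \<le> \<sigma> * x i ^ (m - 1)"
    \<comment> \<open>A constant above \<open>R\<close> is handled by \<open>fst p \<le> R\<close>;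
      any other one comes with a normalised vector lying in \<open>S\<close>.\<close>
    then show "fst p \<le> \<sigma>"
      using norm_in_S[of x \<sigma>] p by (cases "\<sigma> \<le> R") (fastforce simp: S_def)+
  qed
qed

definition strict_set :: "real \<Rightarrow> (nat \<Rightarrow> real) \<Rightarrow> nat set" where
  "strict_set \<rho> x = {i. i < n \<and> ap x i < \<rho> * x i ^ (m - 1)}"

text \<open>Shrinking \<open>x\<close> slightly on the strict set makes every row with an arc into that set strict.\<close>

lemma enlarge_strict_set:
  assumes x: "\<And>i. i < n \<Longrightarrow> 0 < x i" "\<And>i. i < n \<Longrightarrow> ap x i \<le> \<rho> * x i ^ (m - 1)"
    and S: "strict_set \<rho> x \<noteq> {}" "strict_set \<rho> x \<noteq> {..<n}"
  obtains y where "\<And>i. i < n \<Longrightarrow> 0 < y i" "\<And>i. i < n \<Longrightarrow> ap y i \<le> \<rho> * y i ^ (m - 1)"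
    "strict_set \<rho> x \<subset> strict_set \<rho> y"
proof -
  let ?S = "strict_set \<rho> x"
  define y where "y t i = (if i \<in> ?S then (1 - t) * x i else x i)" for t :: real and i
  have cont: "continuous_on UNIV (\<lambda>t. y t i)" for i
    unfolding y_def by (cases "i \<in> ?S") (auto intro!: continuous_intros)
  have "\<forall>\<^sub>F t in at_right 0. ap (y t) i - \<rho> * y t i ^ (m - 1) < 0" if "i \<in> ?S" for i
  proof -
    have "continuous_on UNIV (\<lambda>t. ap (y t) i - \<rho> * y t i ^ (m - 1))"
      by (intro continuous_intros continuous_on_rapply cont)
    then have "((\<lambda>t. ap (y t) i - \<rho> * y t i ^ (m - 1)) \<longlongrightarrow> ap (y 0) i - \<rho> * y 0 i ^ (m - 1)) (at_right 0)"
      unfolding continuous_on_eq_continuous_within by (auto intro: tendsto_mono[OF at_le] simp: continuous_within)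
    moreover have "y 0 = x" by (auto simp: y_def)
    ultimately show ?thesis
      using that by (intro order_tendstoD(2)) (auto simp: strict_set_def)
  qed
  moreover have "finite ?S" by (simp add: strict_set_def)
  ultimately have "\<forall>\<^sub>F t in at_right 0. \<forall>i\<in>?S. ap (y t) i - \<rho> * y t i ^ (m - 1) < 0"
    by (intro eventually_ball_finite) auto
  moreover have "\<forall>\<^sub>F t in at_right 0. t \<in> {0<..<1::real}"
    by (intro eventually_at_right_real) simp
  ultimately have "\<forall>\<^sub>F t in at_right 0. (\<forall>i\<in>?S. ap (y t) i - \<rho> * y t i ^ (m - 1) < 0) \<and> t \<in> {0<..<1::real}"
    by (rule eventually_conj)
  then obtain t where t: "\<And>i. i \<in> ?S \<Longrightarrow> ap (y t) i < \<rho> * y t i ^ (m - 1)" "0 < t" "t < 1"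
    using eventually_happens'[OF trivial_limit_at_right_real] by fastforce
  have ypos: "0 < y t i" if "i < n" for i using x(1)[OF that] t by (simp add: y_def)
  have yle: "y t i \<le> x i" if "i < n" for i using x(1)[OF that] t by (simp add: y_def)
  have ap_le: "ap (y t) i \<le> ap x i" if "i < n" for i
    using that ypos yle by (intro ap_mono) (auto simp: less_imp_le)
  \<comment> \<open>Row \<open>i\<close> has an arc into the shrunk set while its own entry is
    untouched: its left side drops strictly and its right side stays, so \<open>i\<close> joins the
    strict set.\<close>
  obtain i j where ij: "(i, j) \<in> wi_arc b m n" "i \<notin> ?S" "j \<in> ?S"
    using arc_crossing[OF _ S] by (auto simp: strict_set_def)
  then have i: "i < n" "j < n" by (auto simp: wi_arc_def)
  have "ap (y t) i \<noteq> ap x i"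
  proof
    assume "ap (y t) i = ap x i"
    then have "y t j = x j"
      using i ij ypos yle x by (intro ap_eq_imp_eq[of i "y t" x j]) (auto simp: less_imp_le)
    then show False using ij x(1)[OF i(2)] t by (simp add: y_def algebra_simps)
  qed
  then have "i \<in> strict_set \<rho> (y t)"
    using ap_le[OF i(1)] x(2)[OF i(1)] i ij by (auto simp: strict_set_def y_def)
  moreover have "?S \<subseteq> strict_set \<rho> (y t)" using t(1) by (auto simp: strict_set_def)
  ultimately have "?S \<subset> strict_set \<rho> (y t)" using ij by blast
  moreover have "ap (y t) k \<le> \<rho> * y t k ^ (m - 1)" if k: "k < n" for k
  proof (cases "k \<in> ?S")
    case True then show ?thesis using t(1) by (simp add: less_imp_le)
  next
    case False then show ?thesis using ap_le[OF k] x(2)[OF k] by (simp add: y_def)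
  qed
  ultimately show ?thesis using that ypos by blast
qed

text \<open>For the minimal constant no positive vector is strict in every row, since its largest
  row quotient would be a smaller constant. A nonempty strict set could be enlarged again and again
  until it is full; hence it is empty and every row is an equality. The induction is on the number
  of non-strict rows.\<close>

lemma perron_exists:
  obtains \<rho> v where "\<And>i. i < n \<Longrightarrow> 0 < v i" "\<And>i. i < n \<Longrightarrow> ap v i = \<rho> * v i ^ (m - 1)"
proof -
  obtain \<rho> v where v: "\<And>i. i < n \<Longrightarrow> 0 < v i" "\<And>i. i < n \<Longrightarrow> ap v i \<le> \<rho> * v i ^ (m - 1)"
    and least: "\<And>x \<sigma>. \<lbrakk>\<And>i. i < n \<Longrightarrow> 0 < x i; \<And>i. i < n \<Longrightarrow> ap x i \<le> \<sigma> * x i ^ (m - 1)\<rbrakk> \<Longrightarrow> \<rho> \<le> \<sigma>"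
    by (rule minimal_supersolution) metis
  have not_full: "strict_set \<rho> x \<noteq> {..<n}" if x: "\<And>i. i < n \<Longrightarrow> 0 < x i" for x
  proof
    assume full: "strict_set \<rho> x = {..<n}"
    define \<sigma> where "\<sigma> = Max ((\<lambda>i. ap x i / x i ^ (m - 1)) ` {..<n})"
    have "ap x i \<le> \<sigma> * x i ^ (m - 1)" if "i < n" for i
    proof -
      have "ap x i / x i ^ (m - 1) \<le> \<sigma>" unfolding \<sigma>_def using that by (intro Max_ge) auto
      then show ?thesis using x[OF that] by (simp add: field_simps)
    qed
    then have "\<rho> \<le> \<sigma>" using least x by blast
    have "\<sigma> \<in> (\<lambda>i. ap x i / x i ^ (m - 1)) ` {..<n}"
      unfolding \<sigma>_def using n2 by (intro Max_in) (auto simp: lessThan_empty_iff)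
    then obtain i where i: "i < n" "\<sigma> = ap x i / x i ^ (m - 1)" by auto
    have "i \<in> strict_set \<rho> x" using full i by simp
    then have "\<sigma> < \<rho>"
      using i(2) x[OF i(1)] by (simp add: strict_set_def pos_divide_less_eq)
    then show False using \<open>\<rho> \<le> \<sigma>\<close> by simp
  qed
  have empty: "strict_set \<rho> x = {}"
    if "\<And>i. i < n \<Longrightarrow> 0 < x i" "\<And>i. i < n \<Longrightarrow> ap x i \<le> \<rho> * x i ^ (m - 1)" for x
    using that
  proof (induction "n - card (strict_set \<rho> x)" arbitrary: x rule: less_induct)
    case less
    show ?case
    proof (rule ccontr)
      assume "strict_set \<rho> x \<noteq> {}"
      then obtain y where y: "\<And>i. i < n \<Longrightarrow> 0 < y i" "\<And>i. i < n \<Longrightarrow> ap y i \<le> \<rho> * y i ^ (m - 1)"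
        "strict_set \<rho> x \<subset> strict_set \<rho> y"
        using enlarge_strict_set[OF less.prems _ not_full[OF less.prems(1)]] by metis
      have sub: "strict_set \<rho> y \<subseteq> {..<n}" by (auto simp: strict_set_def)
      then have "card (strict_set \<rho> x) < card (strict_set \<rho> y)"
        using y(3) by (meson finite_lessThan finite_subset psubset_card_mono)
      moreover have "card (strict_set \<rho> y) \<le> n"
        using card_mono[OF _ sub] by simp
      ultimately have "strict_set \<rho> y = {}"
        using less.hyps[of y] y by simp
      then show False using y(3) by blast
    qed
  qed
  have "ap v i = \<rho> * v i ^ (m - 1)" if "i < n" for i
    using empty[OF v] v(2)[OF that] that by (force simp: strict_set_def)
  then show ?thesis using that v(1) by blast
qed

end

lemma is_eigenpair_scale:
  assumes "is_eigenpair b m n lam x" "c \<noteq> 0"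
  shows "is_eigenpair b m n lam (\<lambda>i. c * x i)"
proof -
  have "tapply b m n (\<lambda>i. c * x i) i = c ^ (m - 1) * tapply b m n x i" for i
  proof -
    have "tapply b m n (\<lambda>i. c * x i) i
      = (\<Sum>is\<in>tidx (m - 1) n. c ^ (m - 1) * (complex_of_real (b (i # is)) * prod_list (map x is)))"
      unfolding tapply_def
      by (intro sum.cong refl) (auto simp: prod_list_map_mult prod_list_map_const tidx_def)
    then show ?thesis
      by (simp add: tapply_def sum_distrib_left)
  qed
  then show ?thesis
    using assms by (auto simp: is_eigenpair_def power_mult_distrib)
qed

lemma cmod_prod_list_map: "cmod (prod_list (map y xs)) = prod_list (map (\<lambda>i. cmod (y i)) xs)"
  by (induction xs) (auto simp: norm_mult)

context nonneg_tensor
begin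

text \<open>The triangle inequality makes the vector of moduli a candidate for
  \<open>comparison\<close>, with the modulus of the eigenvalue as its constant.\<close>

lemma is_eigenpair_norm_le:
  assumes "is_eigenpair b m n \<mu> y" "i < n"
  shows "cmod \<mu> * cmod (y i) ^ (m - 1) \<le> ap (\<lambda>i. cmod (y i)) i"
proof -
  have "cmod \<mu> * cmod (y i) ^ (m - 1) = cmod (tapply b m n y i)"
    using assms by (simp add: is_eigenpair_def norm_mult norm_power)
  also have "\<dots> \<le> (\<Sum>is\<in>tidx (m - 1) n. cmod (complex_of_real (b (i # is)) * prod_list (map y is)))"
    unfolding tapply_def by (rule norm_sum)
  also have "\<dots> = ap (\<lambda>i. cmod (y i)) i"
    unfolding rapply_def
    using nonneg_Cons[OF assms(2)] by (intro sum.cong refl) (simp add: norm_mult cmod_prod_list_map)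
  finally show ?thesis .
qed

lemma eigenvalue_norm_le:
  assumes v: "\<And>i. i < n \<Longrightarrow> 0 < v i" "\<And>i. i < n \<Longrightarrow> ap v i = \<rho> * v i ^ (m - 1)"
    and y: "is_eigenpair b m n \<mu> y"
  shows "cmod \<mu> \<le> \<rho>" "cmod \<mu> = \<rho> \<Longrightarrow> \<exists>c>0. \<forall>i<n. cmod (y i) = c * v i"
proof -
  have "\<exists>i<n. cmod (y i) \<noteq> 0" using y by (simp add: is_eigenpair_def)
  then show "cmod \<mu> \<le> \<rho>" "cmod \<mu> = \<rho> \<Longrightarrow> \<exists>c>0. \<forall>i<n. cmod (y i) = c * v i"
    using comparison[of v \<rho> "\<lambda>i. cmod (y i)" "cmod \<mu>"] v is_eigenpair_norm_le[OF y] by auto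
qed

text \<open>Equality in the triangle inequality forces the phases of all terms of one row to agree.\<close>

lemma eigenvector_phases:
  assumes v: "\<And>i. i < n \<Longrightarrow> 0 < v i" "\<And>i. i < n \<Longrightarrow> ap v i = \<rho> * v i ^ (m - 1)"
    and y: "is_eigenpair b m n (complex_of_real \<rho>) (\<lambda>i. D i * complex_of_real (v i))"
    and D: "\<And>i. i < n \<Longrightarrow> cmod (D i) = 1"
    and xs: "i < n" "xs \<in> tidx (m - 1) n" "b (i # xs) \<noteq> 0"
  shows "prod_list (map D xs) = D i ^ (m - 1)"
proof -
  define w where "w is = b (i # is) * prod_list (map v is)" for "is"
  \<comment> \<open>\<open>z is\<close> is the phase of a term relative to the common factor
    \<open>D i ^ (m - 1)\<close>. The row equation says that the nonnegative weights
    \<open>w\<close> have the same sum with or without these unit phases.\<close>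
  define z where "z is = prod_list (map D is) / D i ^ (m - 1)" for "is"
  have D0: "D i \<noteq> 0" using D[OF xs(1)] by auto
  have "tapply b m n (\<lambda>i. D i * complex_of_real (v i)) i
      = complex_of_real \<rho> * (D i * complex_of_real (v i)) ^ (m - 1)"
    using y xs(1) by (simp add: is_eigenpair_def)
  also have "tapply b m n (\<lambda>i. D i * complex_of_real (v i)) i
      = (\<Sum>is\<in>tidx (m - 1) n. complex_of_real (w is) * z is * D i ^ (m - 1))"
    unfolding tapply_def w_def z_def using D0
    by (intro sum.cong refl) (simp add: prod_list_map_mult of_real_prod_list_map)
  also have "\<dots> = (\<Sum>is\<in>tidx (m - 1) n. complex_of_real (w is) * z is) * D i ^ (m - 1)"
    by (simp add: sum_distrib_right)
  finally have "(\<Sum>is\<in>tidx (m - 1) n. complex_of_real (w is) * z is) = complex_of_real (\<rho> * v i ^ (m - 1))"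
    using D0 by (simp add: power_mult_distrib)
  also have "\<dots> = complex_of_real (\<Sum>is\<in>tidx (m - 1) n. w is)"
    using v(2)[OF xs(1)] by (simp add: rapply_def w_def)
  finally have "Re (\<Sum>is\<in>tidx (m - 1) n. complex_of_real (w is) * z is) = (\<Sum>is\<in>tidx (m - 1) n. w is)"
    by simp
  then have eq: "(\<Sum>is\<in>tidx (m - 1) n. w is * Re (z is)) = (\<Sum>is\<in>tidx (m - 1) n. w is)"
    by simp
  have norm_z: "cmod (z is) = 1" if "is \<in> tidx (m - 1) n" for "is"
  proof -
    have "map (\<lambda>i. cmod (D i)) is = map (\<lambda>_. 1) is" using D tidxD[OF that] by simp
    then have "cmod (prod_list (map D is)) = 1"
      unfolding cmod_prod_list_map by (simp only: prod_list_map_const power_one)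
    then show ?thesis
      using D[OF xs(1)] by (simp add: z_def norm_divide norm_power)
  qed
  \<comment> \<open>Termwise \<open>w * Re z \<le> w\<close> and equal sums force equality in each
    term; on the unit circle real part 1 means 1.\<close>
  have "w xs * Re (z xs) = w xs"
  proof (rule sum_mono_inv[OF eq])
    fix "is" assume "is": "is \<in> tidx (m - 1) n"
    have "0 \<le> w is" unfolding w_def
      using nonneg_Cons[OF xs(1) "is"] v(1) tidxD[OF "is"]
      by (intro mult_nonneg_nonneg prod_list_nonneg) (auto simp: less_imp_le)
    then show "w is * Re (z is) \<le> w is"
      using norm_z[OF "is"] complex_Re_le_cmod[of "z is"] by (simp add: mult_left_le)
  qed (use xs in auto)
  moreover have "w xs \<noteq> 0"
    using xs(3) prod_list_map_pos[of xs v] v(1) tidxD[OF xs(2)] by (auto simp: w_def)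
  ultimately have "Re (z xs) = 1" by simp
  then have "z xs = 1"
    using norm_z[OF xs(2)] by (auto simp: complex_eq_iff cmod_def)
  then show ?thesis using D0 by (simp add: z_def)
qed

end

section \<open>From Z-tensors to nonnegative tensors\<close>

locale comb_z_tensor =
  fixes A :: "nat list \<Rightarrow> real" and m n :: nat
  assumes order_ge_2: "m \<ge> 2" and dim_ge_2: "n \<ge> 2"
    and A_sym: "comb_symmetric A m n" and A_conn: "weakly_irreducible A m n"
    and A_z: "z_tensor A m n"
begin

text \<open>Any number that dominates all diagonal entries would serve as \<open>s\<close>; this one
  is explicit.\<close>

definition shift :: real where
  "shift = (\<Sum>i<n. \<bar>A (replicate m i)\<bar>)"

definition nonneg_part :: "nat list \<Rightarrow> real" where
  "nonneg_part is = (if \<exists>j\<in>set is. j \<noteq> hd is then - A is else shift - A is)"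

lemma replicate_if_diag: "is \<in> tidx m n \<Longrightarrow> \<forall>j\<in>set is. j = hd is \<Longrightarrow> is = replicate m (hd is)"
  by (metis (mono_tags, lifting) mem_Collect_eq replicate_length_same tidx_def)

text \<open>Passing to \<open>s I - A\<close> changes supports only on the diagonal. A constant
  index list is a permutation of itself alone, and arcs join distinct vertices, so combinatorial
  symmetry and the digraph survive.\<close>

sublocale nonneg_tensor nonneg_part m n
proof
  show "m \<ge> 2" "n \<ge> 2" by (fact order_ge_2, fact dim_ge_2)
  show "0 \<le> nonneg_part is" if "is": "is \<in> tidx m n" for "is"
  proof (cases "\<exists>j\<in>set is. j \<noteq> hd is")
    case True
    then show ?thesis using A_z "is" by (auto simp: nonneg_part_def z_tensor_def)
  next
    case False
    then have rep: "is = replicate m (hd is)" using replicate_if_diag "is" by blast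
    have "is \<noteq> []" using "is" order_ge_2 by (auto simp: tidx_def)
    then have "hd is < n" using tidxD[OF "is"] by simp
    then have "\<bar>A (replicate m (hd is))\<bar> \<le> shift"
      unfolding shift_def by (intro member_le_sum[where f = "\<lambda>i. \<bar>A (replicate m i)\<bar>"]) auto
    then have "A is \<le> shift" using rep by simp
    then show ?thesis using False by (auto simp: nonneg_part_def)
  qed
  show "comb_symmetric nonneg_part m n"
    unfolding comb_symmetric_def
  proof (intro ballI impI)
    fix xs ys assume xs: "xs \<in> tidx m n" and ys: "ys \<in> tidx m n" and eq: "mset xs = mset ys"
    have set_eq: "set xs = set ys" using eq by (metis set_mset_mset)
    have ne: "xs \<noteq> []" "ys \<noteq> []" using xs ys order_ge_2 by (auto simp: tidx_def)
    show "nonneg_part xs \<noteq> 0 \<longleftrightarrow> nonneg_part ys \<noteq> 0"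
    proof (cases "\<exists>j\<in>set xs. j \<noteq> hd xs")
      case True
      then have "\<exists>j\<in>set ys. j \<noteq> hd ys"
        using set_eq ne by (metis list.set_sel(1))
      then have "nonneg_part xs = - A xs" "nonneg_part ys = - A ys"
        unfolding nonneg_part_def using True by (metis (full_types))+
      moreover have "A xs \<noteq> 0 \<longleftrightarrow> A ys \<noteq> 0"
        using A_sym xs ys eq unfolding comb_symmetric_def by metis
      ultimately show ?thesis by simp
    next
      case False
      then have "\<forall>j\<in>set ys. j = hd ys" using set_eq ne by (metis list.set_sel(1))
      then have "ys = replicate m (hd ys)" "xs = replicate m (hd xs)"
        using False replicate_if_diag xs ys by blast+
      moreover have "hd xs = hd ys" using False set_eq ne by (metis list.set_sel(1))
      ultimately show ?thesis by metis
    qed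
  qed
  have "wi_arc nonneg_part m n = wi_arc A m n"
  proof -
    have "nonneg_part (i # is) \<noteq> 0 \<longleftrightarrow> A (i # is) \<noteq> 0" if "j \<in> set is" "j \<noteq> i" for i j "is"
      using that by (auto simp: nonneg_part_def)
    then show ?thesis unfolding wi_arc_def by blast
  qed
  then show "weakly_irreducible nonneg_part m n"
    using A_conn by (simp add: weakly_irreducible_def)
qed

lemma tapply_eq:
  assumes "i < n"
  shows "tapply A m n x i = complex_of_real shift * x i ^ (m - 1) - tapply nonneg_part m n x i"
proof -
  have rep: "replicate (m - 1) i \<in> tidx (m - 1) n" using assms by (auto simp: tidx_def)
  have "A (i # is) = (if is = replicate (m - 1) i then shift else 0) - nonneg_part (i # is)"
    if "is": "is \<in> tidx (m - 1) n" for "is"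
  proof -
    have "(\<exists>j\<in>set is. j \<noteq> i) \<longleftrightarrow> is \<noteq> replicate (m - 1) i"
      using "is" by (auto simp: tidx_def) (metis replicate_length_same)
    then show ?thesis by (simp add: nonneg_part_def)
  qed
  then have "tapply A m n x i = (\<Sum>is\<in>tidx (m - 1) n.
      (if is = replicate (m - 1) i then complex_of_real shift * prod_list (map x is) else 0)
       - complex_of_real (nonneg_part (i # is)) * prod_list (map x is))"
    unfolding tapply_def by (intro sum.cong refl) (simp only:, simp add: left_diff_distrib)
  then show ?thesis
    using rep by (simp add: sum_subtractf tapply_def)
qed

lemma is_eigenpair_nonneg_part:
  "is_eigenpair A m n lam x \<longleftrightarrow> is_eigenpair nonneg_part m n (complex_of_real shift - lam) x"
proof -
  have "tapply A m n x i = lam * x i ^ (m - 1) \<longleftrightarrow>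
      tapply nonneg_part m n x i = (complex_of_real shift - lam) * x i ^ (m - 1)" if "i < n" for i
    unfolding tapply_eq[OF that] left_diff_distrib diff_eq_eq eq_diff_eq by (auto simp: add.commute)
  then show ?thesis unfolding is_eigenpair_def by blast
qed

lemma is_eigenpair_of_real:
  "is_eigenpair nonneg_part m n (complex_of_real \<rho>) (\<lambda>i. complex_of_real (v i)) \<longleftrightarrow>
    (\<forall>i\<ge>n. v i = 0) \<and> (\<exists>i<n. v i \<noteq> 0) \<and> (\<forall>i<n. ap v i = \<rho> * v i ^ (m - 1))"
proof -
  have "tapply nonneg_part m n (\<lambda>i. complex_of_real (v i)) i = complex_of_real \<rho> * complex_of_real (v i) ^ (m - 1)
    \<longleftrightarrow> ap v i = \<rho> * v i ^ (m - 1)" for i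
    unfolding tapply_of_real of_real_power[symmetric] of_real_mult[symmetric] of_real_eq_iff ..
  then show ?thesis by (simp add: is_eigenpair_def)
qed

text \<open>The eigenvalue of \<open>nonneg_part\<close> that corresponds to
  \<open>lambda_min\<close>; the next lemma identifies it as the eigenvalue of the positive
  eigenvector.\<close>

definition perron_rho :: real where
  "perron_rho = shift - lambda_min A m n"

abbreviation "vp \<equiv> perron_vec A m n"

text \<open>This resolves the \<open>LEAST\<close> in \<open>lambda_min\<close> and the
  \<open>THE\<close> in \<open>perron_vec\<close> together. Every eigenvalue of
  \<open>nonneg_part\<close> has modulus at most \<open>\<rho>\<close>, so
  \<open>shift - \<rho>\<close> is least for \<open>A\<close>. A second positive eigenvector is
  proportional to the first, and the first entry 1 fixes the factor.\<close>

lemma perron: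
  shows vp_pos: "\<And>i. i < n \<Longrightarrow> 0 < vp i" and vp_out: "\<And>i. i \<ge> n \<Longrightarrow> vp i = 0"
    and vp_0: "vp 0 = 1" and ap_vp: "\<And>i. i < n \<Longrightarrow> ap vp i = perron_rho * vp i ^ (m - 1)"
proof -
  obtain \<rho> w where w: "\<And>i. i < n \<Longrightarrow> 0 < w i" "\<And>i. i < n \<Longrightarrow> ap w i = \<rho> * w i ^ (m - 1)"
    using perron_exists by metis
  define v where "v i = (if i < n then w i / w 0 else 0)" for i
  have w0: "0 < w 0" using w(1) n2 by simp
  have v: "\<And>i. i < n \<Longrightarrow> 0 < v i" "\<And>i. i \<ge> n \<Longrightarrow> v i = 0" "v 0 = 1"
    using w(1) w0 n2 by (simp_all add: v_def less_imp_neq[OF w0, symmetric])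
  have apv: "ap v i = \<rho> * v i ^ (m - 1)" if "i < n" for i
  proof -
    have "ap v i = ap (\<lambda>i. (1 / w 0) * w i) i" by (rule rapply_cong) (simp add: v_def)
    also have "\<dots> = (1 / w 0) ^ (m - 1) * ap w i" by (rule rapply_scale)
    finally show ?thesis using that w(2)[OF that] by (simp add: v_def power_divide)
  qed
  have v_eig: "is_eigenpair A m n (complex_of_real (shift - \<rho>)) (\<lambda>i. complex_of_real (v i))"
    using is_eigenpair_of_real[of \<rho> v] v apv n2
    by (auto simp: is_eigenpair_nonneg_part intro!: exI[of _ 0])
  have lam: "lambda_min A m n = shift - \<rho>"
    unfolding lambda_min_def
  proof (rule Least_equality)
    show "\<exists>x. is_eigenpair A m n (complex_of_real (shift - \<rho>)) (\<lambda>i. complex_of_real (x i))"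
      using v_eig by blast
    fix lam assume "\<exists>x. is_eigenpair A m n (complex_of_real lam) (\<lambda>i. complex_of_real (x i))"
    then obtain x where "is_eigenpair nonneg_part m n (complex_of_real (shift - lam)) (\<lambda>i. complex_of_real (x i))"
      by (auto simp: is_eigenpair_nonneg_part)
    then have "cmod (complex_of_real (shift - lam)) \<le> \<rho>"
      using eigenvalue_norm_le(1)[of v \<rho>] v(1) apv by blast
    then have "\<bar>shift - lam\<bar> \<le> \<rho>" by (simp only: norm_of_real)
    then show "shift - \<rho> \<le> lam" by linarith
  qed
  have "vp = v"
    unfolding perron_vec_def
  proof (rule the_equality)
    show "(\<forall>i<n. v i > 0) \<and> (\<forall>i\<ge>n. v i = 0) \<and> v 0 = 1 \<and>
      (\<exists>lam::real. is_eigenpair A m n (complex_of_real lam) (\<lambda>i. complex_of_real (v i)))"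
      using v v_eig by blast
    fix u assume "(\<forall>i<n. u i > 0) \<and> (\<forall>i\<ge>n. u i = 0) \<and> u 0 = 1 \<and>
      (\<exists>lam::real. is_eigenpair A m n (complex_of_real lam) (\<lambda>i. complex_of_real (u i)))"
    then obtain lam :: real where u: "\<And>i. i < n \<Longrightarrow> 0 < u i" "\<And>i. i \<ge> n \<Longrightarrow> u i = 0" "u 0 = 1"
      and "is_eigenpair A m n (complex_of_real lam) (\<lambda>i. complex_of_real (u i))"
      by blast
    then have "is_eigenpair nonneg_part m n (complex_of_real (shift - lam)) (\<lambda>i. complex_of_real (u i))"
      by (simp add: is_eigenpair_nonneg_part)
    then have apu: "\<And>i. i < n \<Longrightarrow> ap u i = (shift - lam) * u i ^ (m - 1)"
      using is_eigenpair_of_real[of "shift - lam" u] by blast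
    have ne: "\<exists>i<n. u i \<noteq> 0" "\<exists>i<n. v i \<noteq> 0" using u(3) v(3) n2 by (auto intro!: exI[of _ 0])
    \<comment> \<open>Both vectors are positive eigenvectors, so each can play the dominating role
      in \<open>comparison\<close>.\<close>
    have "shift - lam \<le> \<rho>"
      using comparison(1)[of v \<rho> u "shift - lam"] v apv u apu ne by (auto simp: less_imp_le)
    moreover have "\<rho> \<le> shift - lam"
      using comparison(1)[of u "shift - lam" v \<rho>] v apv u apu ne by (auto simp: less_imp_le)
    ultimately have "shift - lam = \<rho>" by simp
    then obtain c where c: "\<forall>i<n. u i = c * v i"
      using comparison(2)[of v \<rho> u "shift - lam"] v apv u apu ne by (auto simp: less_imp_le)
    then have "c = 1" using u(3) v(3) n2 by simp
    show "u = v"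
    proof
      fix i show "u i = v i" using c \<open>c = 1\<close> u(2) v(2) by (cases "i < n") auto
    qed
  qed
  then show "\<And>i. i < n \<Longrightarrow> 0 < vp i" "\<And>i. i \<ge> n \<Longrightarrow> vp i = 0" "vp 0 = 1"
    "\<And>i. i < n \<Longrightarrow> ap vp i = perron_rho * vp i ^ (m - 1)"
    using v apv lam by (simp_all add: perron_rho_def)
qed

text \<open>Makes the eigenvalue equal to its own modulus, so that the equality case of
  \<open>eigenvalue_norm_le\<close> applies to it.\<close>

lemma perron_rho_nonneg: "0 \<le> perron_rho"
proof -
  have "0 \<le> ap vp 0" using n2 vp_pos by (intro ap_nonneg) (auto simp: less_imp_le)
  then show ?thesis using ap_vp[of 0] vp_0 n2 by simp
qed

lemma min_eigenpair_iff:
  "is_eigenpair A m n (complex_of_real (lambda_min A m n)) y \<longleftrightarrow>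
   is_eigenpair nonneg_part m n (complex_of_real perron_rho) y"
  by (simp add: is_eigenpair_nonneg_part perron_rho_def)

section \<open>Stabilising diagonal matrices and the eigenvectors of the least eigenvalue\<close>

definition stabs :: "(nat \<Rightarrow> complex) set" where
  "stabs = {D. (\<forall>i<n. D i \<noteq> 0) \<and> (\<forall>i\<ge>n. D i = 0) \<and> D 0 = 1 \<and>
     (\<forall>is\<in>tidx m n. A is \<noteq> 0 \<longrightarrow> prod_list (map D (tl is)) = D (hd is) ^ (m - 1))}"

lemma hd_tidx: "is \<in> tidx m n \<Longrightarrow> hd is < n \<and> tl is \<in> tidx (m - 1) n \<and> is = hd is # tl is"
  using m2 by (cases "is") (auto simp: tidx_def)

lemma stab_index_eq: "stab_index A m n = card stabs"
proof -
  have "(complex_of_real (A is) = inverse (D (hd is)) ^ (m - 1) * complex_of_real (A is) * prod_list (map D (tl is)))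
      \<longleftrightarrow> (A is \<noteq> 0 \<longrightarrow> prod_list (map D (tl is)) = D (hd is) ^ (m - 1))"
    if "\<forall>i<n. D i \<noteq> 0" "is \<in> tidx m n" for D "is"
  proof -
    have "D (hd is) \<noteq> 0" using that hd_tidx by blast
    then show ?thesis by (auto simp: field_simps power_inverse)
  qed
  then have "{D. (\<forall>i<n. D i \<noteq> 0) \<and> (\<forall>i\<ge>n. D i = 0) \<and> D 0 = 1 \<and>
      (\<forall>is\<in>tidx m n. complex_of_real (A is) =
          inverse (D (hd is)) ^ (m - 1) * complex_of_real (A is) * prod_list (map D (tl is)))} = stabs"
    unfolding stabs_def by blast
  then show ?thesis by (simp add: stab_index_def)
qed

text \<open>By combinatorial symmetry any index \<open>j\<close> of an edge can be moved to the
  head. The product over the edge is therefore \<open>D j ^ m\<close> for each such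
  \<open>j\<close>, and these powers agree along the edge.\<close>

lemma stabs_prod_list:
  assumes "D \<in> stabs" "is \<in> tidx m n" "A is \<noteq> 0" "j \<in> set is"
  shows "prod_list (map D is) = D j ^ m"
proof -
  let ?ys = "j # remove1 j is"
  have mset: "mset ?ys = mset is" using assms(4) by simp
  then have ys: "?ys \<in> tidx m n" using assms(2) unfolding tidx_def
    by (metis (mono_tags, lifting) mem_Collect_eq mset_eq_setD size_mset)
  then have "A ?ys \<noteq> 0" using A_sym assms(2,3) mset unfolding comb_symmetric_def by metis
  then have "prod_list (map D (tl ?ys)) = D (hd ?ys) ^ (m - 1)"
    using assms(1) ys by (auto simp only: stabs_def mem_Collect_eq)
  then have "prod_list (map D ?ys) = D j * D j ^ (m - 1)" by simp
  moreover have "prod_list (map D ?ys) = prod_list (map D is)"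
    using mset by (metis mset_map prod_mset_prod_list)
  ultimately show ?thesis using m2 by (cases m) auto
qed

text \<open>The power \<open>D i ^ m\<close> is constant along arcs and equals 1 at the index 0,
  which reaches every other index.\<close>

lemma stabs_root:
  assumes "D \<in> stabs" "i < n"
  shows "D i ^ m = 1"
proof -
  have "(0, i) \<in> (wi_arc A m n)\<^sup>*"
    using A_conn assms n2 by (auto simp: weakly_irreducible_def)
  then show ?thesis
  proof (induction rule: rtrancl_induct)
    case base
    then show ?case using assms by (simp add: stabs_def)
  next
    case (step j k)
    obtain xs where "xs \<in> tidx (m - 1) n" "A (j # xs) \<noteq> 0" "k \<in> set xs" "j < n"
      using step.hyps(2) by (auto simp: wi_arc_def)
    then have "j # xs \<in> tidx m n" "A (j # xs) \<noteq> 0" "k \<in> set (j # xs)" "j \<in> set (j # xs)"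
      using Cons_tidx by auto
    then have "D k ^ m = D j ^ m" using stabs_prod_list[OF assms(1)] by metis
    then show ?case using step.IH by simp
  qed
qed

lemma stabs_norm: "D \<in> stabs \<Longrightarrow> i < n \<Longrightarrow> cmod (D i) = 1"
  using power_eq_1_iff[of "D i" m] stabs_root[of D i] m2 by simp

definition eig_of :: "(nat \<Rightarrow> complex) \<Rightarrow> nat \<Rightarrow> complex" where
  "eig_of D i = D i * complex_of_real (vp i)"

lemma min_eigenvectors_eq:
  "{y. is_eigenpair A m n (complex_of_real (lambda_min A m n)) y \<and> y 0 = 1} = eig_of ` stabs"
proof (intro equalityI subsetI)
  fix y assume "y \<in> {y. is_eigenpair A m n (complex_of_real (lambda_min A m n)) y \<and> y 0 = 1}"
  then have y: "is_eigenpair nonneg_part m n (complex_of_real perron_rho) y" "y 0 = 1"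
    by (auto simp: min_eigenpair_iff)
  obtain c where c: "\<forall>i<n. cmod (y i) = c * vp i"
    using eigenvalue_norm_le(2)[OF vp_pos ap_vp y(1)] perron_rho_nonneg by auto
  then have "cmod (y 0) = c * vp 0" using n2 by simp
  then have "c = 1" using y(2) vp_0 by simp
  define D where "D i = (if i < n then y i / complex_of_real (vp i) else 0)" for i
  have D1: "cmod (D i) = 1" if "i < n" for i
    using c \<open>c = 1\<close> vp_pos[OF that] that by (simp add: D_def norm_divide)
  have yD: "y = eig_of D"
  proof
    fix i show "y i = eig_of D i"
      using y(1) vp_pos[of i] by (cases "i < n") (auto simp: D_def eig_of_def is_eigenpair_def)
  qed
  have phases: "prod_list (map D (tl is)) = D (hd is) ^ (m - 1)" if "is": "is \<in> tidx m n" "A is \<noteq> 0" for "is"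
  proof (cases "\<exists>j\<in>set is. j \<noteq> hd is")
    case True
    then have "nonneg_part (hd is # tl is) \<noteq> 0"
      using "is" hd_tidx[OF "is"(1)] by (metis neg_equal_0_iff_equal nonneg_part_def)
    then show ?thesis
      using hd_tidx[OF "is"(1)] y(1) D1 unfolding yD eig_of_def
      by (intro eigenvector_phases[OF vp_pos ap_vp]) auto
  next
    case False
    \<comment> \<open>On the diagonal the supports of \<open>A\<close> and
      \<open>nonneg_part\<close> may differ, but there the required identity is trivial.\<close>
    then have "tl is = replicate (m - 1) (hd is)"
      using replicate_if_diag[OF "is"(1)] by (metis tl_replicate)
    then show ?thesis by (simp add: prod_list_map_const)
  qed
  have "D \<in> stabs"
  proof -
    have "D i \<noteq> 0" if "i < n" for i using D1[OF that] by auto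
    moreover have "D 0 = 1" using y(2) vp_0 n2 by (simp add: D_def)
    moreover have "D i = 0" if "i \<ge> n" for i using that by (simp add: D_def)
    ultimately show ?thesis using phases by (auto simp: stabs_def)
  qed
  then show "y \<in> eig_of ` stabs" using yD by blast
next
  fix y assume "y \<in> eig_of ` stabs"
  then obtain D where D: "D \<in> stabs" "y = eig_of D" by blast
  have "tapply nonneg_part m n y i = complex_of_real perron_rho * y i ^ (m - 1)" if i: "i < n" for i
  proof -
    \<comment> \<open>Every term of row \<open>i\<close> acquires the same factor
      \<open>D i ^ (m - 1)\<close>, so the row equation of \<open>vp\<close> is only
      rescaled.\<close>
    have "complex_of_real (nonneg_part (i # is)) * prod_list (map y is) =
        D i ^ (m - 1) * (complex_of_real (nonneg_part (i # is)) * complex_of_real (prod_list (map vp is)))"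
      if "is": "is \<in> tidx (m - 1) n" for "is"
    proof (cases "nonneg_part (i # is) = 0")
      case False
      have "prod_list (map D is) = D i ^ (m - 1)"
      proof (cases "\<exists>j\<in>set is. j \<noteq> i")
        case True
        then have "A (i # is) \<noteq> 0" using False by (auto simp: nonneg_part_def)
        then show ?thesis
          using D(1) Cons_tidx[OF i "is"] by (auto simp: stabs_def dest!: bspec[of _ _ "i # is"])
      next
        case False
        then have "is = replicate (m - 1) i"
          using "is" by (auto simp: tidx_def) (metis replicate_length_same)
        then show ?thesis by (simp add: prod_list_map_const)
      qed
      then show ?thesis
        unfolding D(2) eig_of_def by (simp add: prod_list_map_mult of_real_prod_list_map)
    qed simp
    then have "tapply nonneg_part m n y i = D i ^ (m - 1) * complex_of_real (ap vp i)"
      unfolding tapply_def rapply_def of_real_sum of_real_mult sum_distrib_left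
      by (intro sum.cong refl) blast
    then show ?thesis
      using ap_vp[OF i] by (simp add: D(2) eig_of_def power_mult_distrib mult_ac)
  qed
  moreover have "y 0 = 1" using D vp_0 by (simp add: eig_of_def stabs_def)
  moreover have "\<forall>i\<ge>n. y i = 0" using D(2) vp_out by (simp add: eig_of_def)
  ultimately show "y \<in> {y. is_eigenpair A m n (complex_of_real (lambda_min A m n)) y \<and> y 0 = 1}"
    unfolding mem_Collect_eq min_eigenpair_iff
    using n2 by (auto simp: is_eigenpair_def intro!: exI[of _ 0])
qed

lemma inj_eig_of: "inj_on eig_of stabs"
proof (rule inj_onI)
  fix D D' assume D: "D \<in> stabs" "D' \<in> stabs" "eig_of D = eig_of D'"
  show "D = D'"
  proof
    fix i
    show "D i = D' i"
      using D(1,2) fun_cong[OF D(3), of i] vp_pos[of i]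
      by (cases "i < n") (auto simp: eig_of_def stabs_def)
  qed
qed

text \<open>The moduli of an eigenvector are a positive multiple of \<open>vp\<close>, so its first
  entry is nonzero. Each projective point thus has exactly one representative with first entry
  1.\<close>

lemma card_PV: "card (PV A m n (complex_of_real (lambda_min A m n))) = card stabs"
proof -
  let ?lam = "complex_of_real (lambda_min A m n)"
  let ?Y = "{y. is_eigenpair A m n ?lam y \<and> y 0 = 1}"
  define cls where "cls x = {(\<lambda>i. c * x i) | c. c \<noteq> 0}" for x :: "nat \<Rightarrow> complex"
  have "bij_betw cls ?Y (PV A m n ?lam)"
  proof (rule bij_betw_imageI)
    show "inj_on cls ?Y"
    proof (rule inj_onI)
      fix x y assume xy: "x \<in> ?Y" "y \<in> ?Y" "cls x = cls y"
      have "x \<in> cls x" unfolding cls_def by (auto intro!: exI[of _ 1])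
      then obtain c where "x = (\<lambda>i. c * y i)" using xy(3) by (auto simp: cls_def)
      moreover from this have "c = 1" using xy(1,2) by simp
      ultimately show "x = y" by simp
    qed
    show "cls ` ?Y = PV A m n ?lam"
    proof (intro equalityI subsetI)
      fix p assume "p \<in> cls ` ?Y"
      then show "p \<in> PV A m n ?lam" by (auto simp: PV_def cls_def)
    next
      fix p assume "p \<in> PV A m n ?lam"
      then obtain x where x: "p = cls x" "is_eigenpair A m n ?lam x"
        by (auto simp: PV_def cls_def)
      then obtain c where c: "c > 0" "\<forall>i<n. cmod (x i) = c * vp i"
        using eigenvalue_norm_le(2)[OF vp_pos ap_vp, of "complex_of_real perron_rho" x]
          perron_rho_nonneg by (auto simp: min_eigenpair_iff)
      have "cmod (x 0) = c" using c(2) n2 vp_0 by simp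
      then have x0: "x 0 \<noteq> 0" using c(1) by auto
      define y where "y = (\<lambda>i. inverse (x 0) * x i)"
      have "y \<in> ?Y" using is_eigenpair_scale[OF x(2), of "inverse (x 0)"] x0 by (simp add: y_def)
      moreover have "cls y = cls x"
      proof (intro equalityI subsetI)
        fix u assume "u \<in> cls y"
        then obtain k where "k \<noteq> 0" "u = (\<lambda>i. k * y i)" by (auto simp: cls_def)
        then have "k * inverse (x 0) \<noteq> 0" "u = (\<lambda>i. (k * inverse (x 0)) * x i)"
          using x0 by (auto simp: y_def mult_ac)
        then show "u \<in> cls x" unfolding cls_def by blast
      next
        fix u assume "u \<in> cls x"
        then obtain k where "k \<noteq> 0" "u = (\<lambda>i. k * x i)" by (auto simp: cls_def)
        then have "k * x 0 \<noteq> 0" "u = (\<lambda>i. (k * x 0) * y i)"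
          using x0 by (auto simp: y_def mult_ac)
        then show "u \<in> cls y" unfolding cls_def by blast
      qed
      ultimately show "p \<in> cls ` ?Y" using x(1) by blast
    qed
  qed
  then have "card (PV A m n ?lam) = card ?Y" by (rule bij_betw_same_card[symmetric])
  also have "\<dots> = card stabs"
    unfolding min_eigenvectors_eq by (rule card_image[OF inj_eig_of])
  finally show ?thesis .
qed

section \<open>The group structure on the eigenvectors\<close>

lemma carrier_PV_group: "carrier (PV_group A m n) = eig_of ` stabs"
  using min_eigenvectors_eq by (simp add: PV_group_def)

text \<open>The matrix \<open>D_y\<close> recovers \<open>D\<close> because \<open>D\<close> has
  unit entries and \<open>vp\<close> is positive. Hence the product in \<open>PV_group\<close> is
  the entrywise product of stabilising matrices.\<close>

lemma sgn_eig_of: "D \<in> stabs \<Longrightarrow> i < n \<Longrightarrow> sgn (eig_of D i) = D i"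
proof -
  assume D: "D \<in> stabs" "i < n"
  have "sgn (eig_of D i) = sgn (D i) * complex_of_real (sgn (vp i))"
    by (simp add: eig_of_def sgn_mult sgn_of_real)
  then show ?thesis
    using vp_pos[OF D(2)] stabs_norm[OF D] by (simp add: sgn_eq)
qed

lemma stabs_mult: "D \<in> stabs \<Longrightarrow> D' \<in> stabs \<Longrightarrow> (\<lambda>i. D i * D' i) \<in> stabs"
  by (simp add: stabs_def prod_list_map_mult power_mult_distrib)

lemma stabs_one: "(\<lambda>i. if i < n then 1 else 0) \<in> stabs"
proof -
  have "prod_list (map (\<lambda>i. if i < n then 1 else 0) (tl is)) = (1 :: complex)" if "is \<in> tidx m n" for "is"
  proof -
    have "map (\<lambda>i. if i < n then 1 else 0 :: complex) (tl is) = map (\<lambda>_. 1) (tl is)"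
      using tidxD[of "tl is" "m - 1" n] hd_tidx[OF that, THEN conjunct2, THEN conjunct1] by auto
    then show ?thesis by (simp only: prod_list_map_const power_one)
  qed
  moreover have "hd is < n" if "is \<in> tidx m n" for "is" using hd_tidx[OF that] by blast
  ultimately show ?thesis using n2 by (simp add: stabs_def)
qed

lemma stabs_inverse: "D \<in> stabs \<Longrightarrow> (\<lambda>i. inverse (D i)) \<in> stabs"
proof -
  have "prod_list (map (\<lambda>i. inverse (D i)) xs) = inverse (prod_list (map D xs))" for xs and D :: "nat \<Rightarrow> complex"
    by (induction xs) (auto simp: mult_ac)
  then show "D \<in> stabs \<Longrightarrow> (\<lambda>i. inverse (D i)) \<in> stabs"
    by (auto simp: stabs_def power_inverse)
qed

lemma mult_PV_group:
  assumes "D \<in> stabs" "D' \<in> stabs"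
  shows "eig_of D \<otimes>\<^bsub>PV_group A m n\<^esub> eig_of D' = eig_of (\<lambda>i. D i * D' i)"
proof
  fix i
  show "(eig_of D \<otimes>\<^bsub>PV_group A m n\<^esub> eig_of D') i = eig_of (\<lambda>i. D i * D' i) i"
    using sgn_eig_of[OF assms(1)] sgn_eig_of[OF assms(2)] vp_out[of i]
    by (cases "i < n") (auto simp: PV_group_def eig_of_def)
qed

lemma one_PV_group: "\<one>\<^bsub>PV_group A m n\<^esub> = eig_of (\<lambda>i. if i < n then 1 else 0)"
  by (simp add: PV_group_def eig_of_def fun_eq_iff vp_out)

lemma comm_group_PV_group: "comm_group (PV_group A m n)"
proof (rule comm_groupI)
  fix x assume "x \<in> carrier (PV_group A m n)"
  then obtain D where D: "D \<in> stabs" "x = eig_of D" by (auto simp: carrier_PV_group)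
  have *: "(\<lambda>i. (if i < n then 1 else 0) * D i) = D" "(\<lambda>i. inverse (D i) * D i) = (\<lambda>i. if i < n then 1 else 0)"
    using D(1) by (auto simp: stabs_def fun_eq_iff)
  show "\<one>\<^bsub>PV_group A m n\<^esub> \<otimes>\<^bsub>PV_group A m n\<^esub> x = x"
    using D stabs_one by (simp add: one_PV_group mult_PV_group *)
  show "\<exists>y\<in>carrier (PV_group A m n). y \<otimes>\<^bsub>PV_group A m n\<^esub> x = \<one>\<^bsub>PV_group A m n\<^esub>"
  proof
    show "eig_of (\<lambda>i. inverse (D i)) \<otimes>\<^bsub>PV_group A m n\<^esub> x = \<one>\<^bsub>PV_group A m n\<^esub>"
      unfolding D(2) mult_PV_group[OF stabs_inverse[OF D(1)] D(1)] * one_PV_group ..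
    show "eig_of (\<lambda>i. inverse (D i)) \<in> carrier (PV_group A m n)"
      using stabs_inverse[OF D(1)] by (simp add: carrier_PV_group)
  qed
next
  fix x y assume "x \<in> carrier (PV_group A m n)" "y \<in> carrier (PV_group A m n)"
  then obtain D E where D: "D \<in> stabs" "x = eig_of D" and E: "E \<in> stabs" "y = eig_of E"
    by (auto simp: carrier_PV_group)
  show "x \<otimes>\<^bsub>PV_group A m n\<^esub> y \<in> carrier (PV_group A m n)"
    using D E by (simp add: carrier_PV_group mult_PV_group stabs_mult)
  show "x \<otimes>\<^bsub>PV_group A m n\<^esub> y = y \<otimes>\<^bsub>PV_group A m n\<^esub> x"
    using D E by (simp add: mult_PV_group mult.commute)
  fix z assume "z \<in> carrier (PV_group A m n)"
  then obtain F where "F \<in> stabs" "z = eig_of F" by (auto simp: carrier_PV_group)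
  then show "x \<otimes>\<^bsub>PV_group A m n\<^esub> y \<otimes>\<^bsub>PV_group A m n\<^esub> z
      = x \<otimes>\<^bsub>PV_group A m n\<^esub> (y \<otimes>\<^bsub>PV_group A m n\<^esub> z)"
    using D E by (simp add: mult_PV_group stabs_mult mult.assoc)
qed (simp add: carrier_PV_group one_PV_group stabs_one)

text \<open>The case distinction guards \<open>k = 0\<close>, where \<open>D i ^ 0\<close> is 1 even
  outside the index range. Membership in \<open>stabs\<close> is carried along because the induction
  step multiplies by \<open>mult_PV_group\<close>.\<close>

lemma pow_PV_group:
  assumes "D \<in> stabs"
  shows "eig_of D [^]\<^bsub>PV_group A m n\<^esub> k = eig_of (\<lambda>i. if i < n then D i ^ k else 0) \<and>
    (\<lambda>i. if i < n then D i ^ k else 0) \<in> stabs"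
proof (induction k)
  case 0
  then show ?case using stabs_one by (simp add: one_PV_group cong: if_cong)
next
  case (Suc k)
  have *: "(\<lambda>i. (if i < n then D i ^ k else 0) * D i) = (\<lambda>i. if i < n then D i ^ Suc k else 0)"
    by auto
  then have "(\<lambda>i. if i < n then D i ^ Suc k else 0) \<in> stabs"
    using stabs_mult[OF conjunct2[OF Suc.IH] assms] by simp
  moreover have "eig_of D [^]\<^bsub>PV_group A m n\<^esub> Suc k = eig_of (\<lambda>i. if i < n then D i ^ Suc k else 0)"
    using Suc.IH mult_PV_group[OF conjunct2[OF Suc.IH] assms] unfolding * by simp
  ultimately show ?case by blast
qed

lemma pow_m_PV_group:
  assumes "y \<in> carrier (PV_group A m n)"
  shows "y [^]\<^bsub>PV_group A m n\<^esub> m = \<one>\<^bsub>PV_group A m n\<^esub>"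
proof -
  obtain D where D: "D \<in> stabs" "y = eig_of D" using assms by (auto simp: carrier_PV_group)
  have "(\<lambda>i. if i < n then D i ^ m else 0) = (\<lambda>i. if i < n then 1 else 0)"
    using stabs_root[OF D(1)] by auto
  then show ?thesis using pow_PV_group[OF D(1), of m] D(2) by (simp add: one_PV_group)
qed

end

section \<open>The kernel of the incidence matrix\<close>

lemma coprime_if_no_common_prime:
  fixes a c :: int
  assumes "c \<noteq> 0" "\<And>p. Factorial_Ring.prime p \<Longrightarrow> p dvd c \<Longrightarrow> \<not> p dvd a"
  shows "coprime a c"
proof (rule ccontr)
  assume "\<not> coprime a c"
  then have "\<not> is_unit (gcd a c)" by (simp only: is_unit_gcd) simp
  moreover have "gcd a c \<noteq> 0" using assms(1) by simp
  ultimately obtain p where "p dvd gcd a c" "Factorial_Ring.prime p"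
    using prime_divisor_exists by blast
  then show False using assms(2) by auto
qed

text \<open>For each prime \<open>p\<close> of \<open>c\<close> one prescribes whether
  \<open>p\<close> divides \<open>a\<close> or \<open>b\<close>. If \<open>p\<close> does not divide
  \<open>s\<close>, it divides \<open>a\<close> only; if it divides \<open>s\<close> but not
  \<open>t\<close>, it divides \<open>b\<close> only; if it divides both, it divides neither. In
  each case exactly one summand of either expression survives modulo \<open>p\<close>.\<close>

lemma simultaneous_units:
  fixes s t c :: int
  assumes "c \<noteq> 0"
  obtains a b where "coprime (a + b * s) c" "coprime (a * t + b) c"
proof -
  define a where "a = \<Prod>{p\<in>prime_factors c. \<not> p dvd s}"
  define b where "b = \<Prod>{p\<in>prime_factors c. p dvd s \<and> \<not> p dvd t}"
  have dvd_prod: "p dvd \<Prod>{q\<in>prime_factors c. R q} \<longleftrightarrow> R p"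
    if p: "Factorial_Ring.prime p" "p dvd c" for p and R :: "int \<Rightarrow> bool"
  proof -
    have "p dvd \<Prod>{q\<in>prime_factors c. R q} \<longleftrightarrow> (\<exists>q\<in>{q\<in>prime_factors c. R q}. p dvd q)"
      using p by (subst prime_dvd_prod_iff) auto
    also have "\<dots> \<longleftrightarrow> R p"
      using p primes_dvd_imp_eq[of p] assms by (auto simp: in_prime_factors_iff)
    finally show ?thesis .
  qed
  have "\<not> p dvd a + b * s \<and> \<not> p dvd a * t + b"
    if p: "Factorial_Ring.prime p" "p dvd c" for p
  proof -
    have pa: "p dvd a \<longleftrightarrow> \<not> p dvd s" and pb: "p dvd b \<longleftrightarrow> p dvd s \<and> \<not> p dvd t"
      unfolding a_def b_def using dvd_prod[OF p] by auto
    have mult: "p dvd b * s \<longleftrightarrow> p dvd b \<or> p dvd s" "p dvd a * t \<longleftrightarrow> p dvd a \<or> p dvd t"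
      using p(1) by (simp_all add: prime_dvd_mult_iff)
    consider "\<not> p dvd s" | "p dvd s" "\<not> p dvd t" | "p dvd s" "p dvd t" by blast
    then show ?thesis
    proof cases
      case 1 then show ?thesis using pa pb mult by (simp add: dvd_add_right_iff)
    next
      case 2 then show ?thesis using pa pb mult by (simp add: dvd_add_left_iff)
    next
      case 3 then show ?thesis using pa pb mult by (simp add: dvd_add_left_iff dvd_add_right_iff)
    qed
  qed
  then have "coprime (a + b * s) c" "coprime (a * t + b) c"
    using coprime_if_no_common_prime[OF assms] by blast+
  then show ?thesis using that by blast
qed

lemma cong_left_inverse_apply:
  fixes M :: "'a \<Rightarrow> 'b \<Rightarrow> int"
  assumes "finite I" "i \<in> I"
    and "\<And>j. j \<in> I \<Longrightarrow> [(\<Sum>k\<in>K. M i k * M' k j) = (if i = j then 1 else 0)] (mod c)"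
  shows "[(\<Sum>k\<in>K. M i k * (\<Sum>j\<in>I. M' k j * x j)) = x i] (mod c)"
proof -
  have "(\<Sum>k\<in>K. M i k * (\<Sum>j\<in>I. M' k j * x j)) = (\<Sum>j\<in>I. (\<Sum>k\<in>K. M i k * M' k j) * x j)"
    unfolding sum_distrib_left sum_distrib_right by (subst sum.swap) (simp add: mult_ac)
  also have "[\<dots> = (\<Sum>j\<in>I. (if i = j then 1 else 0) * x j)] (mod c)"
    using assms(3) by (intro cong_sum cong_mult cong_refl)
  also have "(\<Sum>j\<in>I. (if i = j then 1 else 0) * x j) = x i"
    using assms(1,2) by (simp add: if_distrib[of "\<lambda>u. u * _"] cong: if_cong)
  finally show ?thesis .
qed

text \<open>Elements are unreduced integer lifts with arbitrary values outside the index range; two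
  of them represent the same residue vector when they agree modulo \<open>m\<close> on
  \<open>{..<n}\<close>.\<close>

definition kernel_Zm :: "(nat list \<Rightarrow> real) \<Rightarrow> nat \<Rightarrow> nat \<Rightarrow> (nat \<Rightarrow> int) set" where
  "kernel_Zm A m n = {x. \<forall>e\<in>edges A m n. int m dvd (\<Sum>l<n. incidence e l * x l)}"

text \<open>Here \<open>q x\<close> is \<open>Q' x\<close>, with \<open>Q'\<close> inverse to
  \<open>Q\<close> modulo \<open>m\<close>. Then \<open>P B x\<close> is the diagonal matrix applied
  to \<open>q x\<close>, and invertibility of \<open>P\<close> makes it vanish exactly when
  \<open>B x\<close> does. The conclusion keeps these consequences and hides the matrices.\<close>

lemma snf_Zm_coordinates:
  assumes snf: "snf_Zm A m n r d" and fin: "finite (edges A m n)"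
  obtains q :: "(nat \<Rightarrow> int) \<Rightarrow> nat \<Rightarrow> int" where
    "\<And>a b x y k. q (\<lambda>i. a * x i + b * y i) k = a * q x k + b * q y k"
    "\<And>x. (\<forall>k<n. int m dvd q x k) \<longleftrightarrow> (\<forall>i<n. int m dvd x i)"
    "\<And>z. \<exists>x. \<forall>k<n. int m dvd q x k - z k"
    "\<And>x. x \<in> kernel_Zm A m n \<longleftrightarrow> (\<forall>k<r. int m dvd int (d k) * q x k)"
proof -
  let ?E = "edges A m n" and ?N = "card (edges A m n)"
  from snf obtain P P' Q Q' where rN: "r \<le> ?N" and rn: "r \<le> n"
    and "\<forall>e\<in>?E. \<forall>e'\<in>?E. cong_Zm (\<Sum>k<?N. P' e k * P k e') (if e = e' then 1 else 0) m"
    and "\<forall>i<n. \<forall>j<n. cong_Zm (\<Sum>k<n. Q i k * Q' k j) (if i = j then 1 else 0) m"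
    and "\<forall>i<n. \<forall>j<n. cong_Zm (\<Sum>k<n. Q' i k * Q k j) (if i = j then 1 else 0) m"
    and "\<forall>k<?N. \<forall>j<n. cong_Zm (\<Sum>e\<in>?E. \<Sum>l<n. P k e * incidence e l * Q l j)
                (if k = j \<and> k < r then int (d k) else 0) m"
    unfolding snf_Zm_def Let_def by (elim conjE exE) (rule that)
  then have PP: "\<And>e e'. e \<in> ?E \<Longrightarrow> e' \<in> ?E \<Longrightarrow>
      [(\<Sum>k<?N. P' e k * P k e') = (if e = e' then 1 else 0)] (mod int m)"
    and QQ: "\<And>i j. i < n \<Longrightarrow> j < n \<Longrightarrow>
      [(\<Sum>k<n. Q i k * Q' k j) = (if i = j then 1 else 0)] (mod int m)"
    and QQ': "\<And>i j. i < n \<Longrightarrow> j < n \<Longrightarrow>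
      [(\<Sum>k<n. Q' i k * Q k j) = (if i = j then 1 else 0)] (mod int m)"
    and PBQ: "\<And>k j. k < ?N \<Longrightarrow> j < n \<Longrightarrow>
      [(\<Sum>e\<in>?E. \<Sum>l<n. P k e * incidence e l * Q l j) = (if k = j \<and> k < r then int (d k) else 0)] (mod int m)"
    by (simp_all add: cong_Zm_def cong_def)
  define q where "q x k = (\<Sum>j<n. Q' k j * x j)" for x k
  have Qq: "[(\<Sum>k<n. Q i k * q x k) = x i] (mod int m)" if "i < n" for i x
    unfolding q_def using that QQ by (intro cong_left_inverse_apply) auto
  have qQ: "[q (\<lambda>i. \<Sum>k<n. Q i k * z k) j = z j] (mod int m)" if "j < n" for j z
    unfolding q_def using that QQ' by (intro cong_left_inverse_apply) auto
  \<comment> \<open>Insert \<open>x = Q (q x)\<close> and collect \<open>P B Q\<close>, which is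
    diagonal; its rows from \<open>r\<close> on vanish.\<close>
  have PB: "[(\<Sum>e\<in>?E. P k e * (\<Sum>l<n. incidence e l * x l)) = (if k < r then int (d k) * q x k else 0)] (mod int m)"
    if k: "k < ?N" for k x
  proof -
    have "[(\<Sum>e\<in>?E. P k e * (\<Sum>l<n. incidence e l * x l))
        = (\<Sum>e\<in>?E. P k e * (\<Sum>l<n. incidence e l * (\<Sum>j<n. Q l j * q x j)))] (mod int m)"
      using Qq by (intro cong_sum cong_mult cong_refl) (auto intro: cong_sym)
    also have "(\<Sum>e\<in>?E. P k e * (\<Sum>l<n. incidence e l * (\<Sum>j<n. Q l j * q x j)))
        = (\<Sum>e\<in>?E. \<Sum>l<n. \<Sum>j<n. P k e * incidence e l * Q l j * q x j)"
      by (simp add: sum_distrib_left mult.assoc)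
    also have "\<dots> = (\<Sum>e\<in>?E. \<Sum>j<n. \<Sum>l<n. P k e * incidence e l * Q l j * q x j)"
      by (intro sum.cong refl sum.swap)
    also have "\<dots> = (\<Sum>j<n. \<Sum>e\<in>?E. \<Sum>l<n. P k e * incidence e l * Q l j * q x j)"
      by (rule sum.swap)
    also have "\<dots> = (\<Sum>j<n. (\<Sum>e\<in>?E. \<Sum>l<n. P k e * incidence e l * Q l j) * q x j)"
      by (simp add: sum_distrib_right)
    also have "[\<dots> = (\<Sum>j<n. (if k = j \<and> k < r then int (d k) else 0) * q x j)] (mod int m)"
      using PBQ[OF k] by (intro cong_sum cong_mult cong_refl) auto
    also have "(\<Sum>j<n. (if k = j \<and> k < r then int (d k) else 0) * q x j)
        = (\<Sum>j<n. if j = k then (if k < r then int (d k) * q x k else 0) else 0)"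
      by (intro sum.cong) auto
    also have "\<dots> = (if k < r then int (d k) * q x k else 0)"
      using rn by simp
    finally show ?thesis .
  qed
  show ?thesis
  proof (rule that[of q])
    show "q (\<lambda>i. a * x i + b * y i) k = a * q x k + b * q y k" for a b x y k
      unfolding q_def sum_distrib_left sum.distrib[symmetric]
      by (intro sum.cong refl) (simp add: algebra_simps)
    show "(\<forall>k<n. int m dvd q x k) \<longleftrightarrow> (\<forall>i<n. int m dvd x i)" for x
    proof
      assume *: "\<forall>k<n. int m dvd q x k"
      show "\<forall>i<n. int m dvd x i"
      proof (intro allI impI)
        fix i assume i: "i < n"
        have "int m dvd (\<Sum>k<n. Q i k * q x k)" using * by (intro dvd_sum) auto
        then show "int m dvd x i" using Qq[OF i, of x] cong_dvd_iff cong_sym by blast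
      qed
    next
      assume "\<forall>i<n. int m dvd x i"
      then show "\<forall>k<n. int m dvd q x k" unfolding q_def by (auto intro!: dvd_sum)
    qed
    show "\<exists>x. \<forall>k<n. int m dvd q x k - z k" for z
      using qQ[of _ z] by (intro exI[of _ "\<lambda>i. \<Sum>k<n. Q i k * z k"]) (auto simp: cong_iff_dvd_diff)
    show "x \<in> kernel_Zm A m n \<longleftrightarrow> (\<forall>k<r. int m dvd int (d k) * q x k)" for x
    proof
      assume "x \<in> kernel_Zm A m n"
      then have *: "int m dvd (\<Sum>l<n. incidence e l * x l)" if "e \<in> ?E" for e
        using that by (auto simp: kernel_Zm_def)
      show "\<forall>k<r. int m dvd int (d k) * q x k"
      proof (intro allI impI)
        fix k assume k: "k < r"
        have "int m dvd (\<Sum>e\<in>?E. P k e * (\<Sum>l<n. incidence e l * x l))"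
          by (rule dvd_sum) (rule dvd_mult, rule *)
        moreover have "k < ?N" using k rN by simp
        ultimately show "int m dvd int (d k) * q x k"
          using cong_dvd_iff[OF PB[of k x]] k by (simp only: if_True)
      qed
    next
      assume *: "\<forall>k<r. int m dvd int (d k) * q x k"
      have PB0: "int m dvd (\<Sum>e\<in>?E. P k e * (\<Sum>l<n. incidence e l * x l))" if "k < ?N" for k
        unfolding cong_dvd_iff[OF PB[OF that, of x]] using * by simp
      show "x \<in> kernel_Zm A m n"
        unfolding kernel_Zm_def
      proof safe
        fix e assume e: "e \<in> ?E"
        have "[(\<Sum>k<?N. P' e k * (\<Sum>e'\<in>?E. P k e' * (\<Sum>l<n. incidence e' l * x l)))
            = (\<Sum>l<n. incidence e l * x l)] (mod int m)"
          using fin e PP by (intro cong_left_inverse_apply[where x = "\<lambda>e. \<Sum>l<n. incidence e l * x l"]) auto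
        moreover have "int m dvd (\<Sum>k<?N. P' e k * (\<Sum>e'\<in>?E. P k e' * (\<Sum>l<n. incidence e' l * x l)))"
          by (rule dvd_sum) (rule dvd_mult, rule PB0, simp)
        ultimately show "int m dvd (\<Sum>l<n. incidence e l * x l)"
          using cong_dvd_iff by blast
      qed
    qed
  qed
qed

section \<open>Splitting the kernel and cancelling one free summand\<close>

locale kernel_coordinates =
  fixes q :: "(nat \<Rightarrow> int) \<Rightarrow> nat \<Rightarrow> int" and m n r :: nat and d :: "nat \<Rightarrow> nat"
  assumes m2: "m \<ge> 2" and n_pos: "0 < n" and r_less: "r < n"
    and d_dvd: "\<And>i. i < r \<Longrightarrow> d i dvd m"
    and q_lin: "\<And>a b x y k. q (\<lambda>i. a * x i + b * y i) k = a * q x k + b * q y k"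
    and q_zero: "\<And>x. (\<forall>k<n. int m dvd q x k) \<longleftrightarrow> (\<forall>i<n. int m dvd x i)"
    and q_surj: "\<And>z. \<exists>x. \<forall>k<n. int m dvd q x k - z k"
    and q_ones: "\<And>k. k < r \<Longrightarrow> int m dvd int (d k) * q (\<lambda>_. 1) k"
begin

definition K :: "(nat \<Rightarrow> int) set" where
  "K = {x. \<forall>k<r. int m dvd int (d k) * q x k}"

definition K0 :: "(nat \<Rightarrow> int) set" where
  "K0 = {x\<in>K. int m dvd x 0}"

text \<open>The order of the cyclic group through which the coordinate \<open>q x i\<close> of a
  kernel element ranges: the annihilator of \<open>d i\<close> for \<open>i < r\<close>, and all of
  the integers modulo \<open>m\<close> from \<open>r\<close> on.\<close>

definition modulus :: "nat \<Rightarrow> nat" where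
  "modulus i = (if i < r then d i else m)"

lemma q_add: "q (\<lambda>i. x i + y i) k = q x k + q y k"
  using q_lin[of 1 x 1 y k] by simp

lemma q_diff: "q (\<lambda>i. x i - y i) k = q x k - q y k"
  using q_lin[of 1 x "-1" y k] by simp

lemma K_lin: "x \<in> K \<Longrightarrow> y \<in> K \<Longrightarrow> (\<lambda>i. a * x i + b * y i) \<in> K"
proof -
  assume "x \<in> K" "y \<in> K"
  moreover have "int (d k) * q (\<lambda>i. a * x i + b * y i) k = a * (int (d k) * q x k) + b * (int (d k) * q y k)" for k
    unfolding q_lin by (simp add: algebra_simps)
  ultimately show ?thesis by (simp add: K_def)
qed

lemma K0_add: "x \<in> K0 \<Longrightarrow> y \<in> K0 \<Longrightarrow> (\<lambda>i. x i + y i) \<in> K0"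
  using K_lin[of x y 1 1] by (auto simp: K0_def)

lemma modulus_dvd: "int (modulus i) * (int m div int (modulus i)) = int m"
proof -
  have "modulus i dvd m" using d_dvd by (auto simp: modulus_def)
  then have "int (modulus i) dvd int m" by simp
  then show ?thesis by (rule dvd_mult_div_cancel)
qed

text \<open>The annihilator of a divisor of \<open>m\<close> is generated by the complementary
  divisor; for an unconstrained coordinate the cofactor is 1.\<close>

lemma cofactor_dvd_q:
  assumes "x \<in> K"
  shows "int m div int (modulus i) dvd q x i"
proof (cases "i < r")
  case True
  then have "int (modulus i) * (int m div int (modulus i)) dvd int (modulus i) * q x i"
    using assms unfolding modulus_dvd by (auto simp: K_def modulus_def)
  moreover have "int (modulus i) \<noteq> 0" using modulus_dvd[of i] m2 by (intro notI) simp
  ultimately show ?thesis by simp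
next
  case False
  then show ?thesis using m2 by (simp add: modulus_def)
qed

text \<open>Both the projection \<open>x \<mapsto> x 0\<close> and the coordinate \<open>x \<mapsto> q x r\<close> split off a free summand of the
  kernel. A vector on which both take unit values is a common complement of their kernels, which are
  therefore isomorphic.\<close>

lemma common_complement:
  obtains v g h where "v \<in> K" "int m dvd g * q v r - 1" "int m dvd h * v 0 - 1"
proof -
  \<comment> \<open>\<open>w\<close> is the basis vector dual to the coordinate \<open>r\<close>;
    the constraints concern only the coordinates below \<open>r\<close>, so it lies in the
    kernel.\<close>
  obtain w where w: "\<forall>k<n. int m dvd q w k - (if k = r then 1 else 0)"
    using q_surj[of "\<lambda>k. if k = r then 1 else 0"] by blast
  have "w \<in> K"
    unfolding K_def
  proof safe
    fix k assume "k < r"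
    then show "int m dvd int (d k) * q w k" using w r_less by (auto dest!: spec[of _ k])
  qed
  have ones: "(\<lambda>_. 1) \<in> K" using q_ones by (simp add: K_def)
  \<comment> \<open>On \<open>v = a * 1 + b * w\<close> the two functionals take the values
    \<open>a + b * w 0\<close> and, modulo \<open>m\<close>, \<open>a * q 1 r + b\<close>. The
    numbers \<open>h\<close> and \<open>g\<close> below invert them.\<close>
  obtain a b where ab: "coprime (a + b * w 0) (int m)" "coprime (a * q (\<lambda>_. 1) r + b) (int m)"
    using simultaneous_units[of "int m" "w 0" "q (\<lambda>_. 1) r"] m2 by auto
  define v where "v = (\<lambda>i. a * 1 + b * w i)"
  have "v \<in> K" unfolding v_def by (rule K_lin[OF ones \<open>w \<in> K\<close>])
  obtain h where h: "int m dvd (a + b * w 0) * h - 1"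
    using cong_solve_coprime_int[OF ab(1)] by (auto simp: cong_iff_dvd_diff)
  obtain g where g: "int m dvd (a * q (\<lambda>_. 1) r + b) * g - 1"
    using cong_solve_coprime_int[OF ab(2)] by (auto simp: cong_iff_dvd_diff)
  have qv: "q v r = a * q (\<lambda>_. 1) r + b * q w r"
    unfolding v_def by (rule q_lin)
  have "g * q v r - 1 = ((a * q (\<lambda>_. 1) r + b) * g - 1) + g * b * (q w r - 1)"
    unfolding qv by (simp add: algebra_simps)
  moreover have "int m dvd q w r - 1" using w r_less by (auto dest!: spec[of _ r])
  ultimately have "int m dvd g * q v r - 1" using g by (simp only: dvd_add dvd_mult)
  moreover have "int m dvd h * v 0 - 1" using h by (simp add: v_def mult.commute)
  ultimately show ?thesis using that \<open>v \<in> K\<close> by blast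
qed

text \<open>Project \<open>K0\<close> along \<open>v\<close> onto the vectors with vanishing
  \<open>r\<close>-th coordinate and divide the other coordinates by their cofactors. The projection
  is injective because \<open>v 0\<close> is a unit, and it is onto because a multiple of
  \<open>v\<close> can correct the entry at 0.\<close>

lemma kernel_decomposition:
  obtains w :: "(nat \<Rightarrow> int) \<Rightarrow> nat \<Rightarrow> int" where
    "\<And>x y i. x \<in> K0 \<Longrightarrow> y \<in> K0 \<Longrightarrow> w (\<lambda>i. x i + y i) i = w x i + w y i"
    "\<And>x y. x \<in> K0 \<Longrightarrow> y \<in> K0 \<Longrightarrow>
      (\<forall>i<n. i \<noteq> r \<longrightarrow> [w x i = w y i] (mod int (modulus i))) \<longleftrightarrow> (\<forall>i<n. [x i = y i] (mod int m))"
    "\<And>t. \<exists>x\<in>K0. \<forall>i<n. i \<noteq> r \<longrightarrow> [w x i = t i] (mod int (modulus i))"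
proof -
  obtain v g h where v: "v \<in> K" and g: "int m dvd g * q v r - 1" and h: "int m dvd h * v 0 - 1"
    by (rule common_complement)
  \<comment> \<open>The coordinates of \<open>x - g * q x r * v\<close>. Since \<open>g\<close>
    inverts \<open>q v r\<close>, the coordinate \<open>r\<close> becomes 0 modulo
    \<open>m\<close>.\<close>
  define z where "z x i = q x i - g * q x r * q v i" for x i
  define cof where "cof i = int m div int (modulus i)" for i
  define w where "w x i = z x i div cof i" for x i
  have cof: "int (modulus i) * cof i = int m" for i by (simp add: cof_def modulus_dvd)
  have cof0: "cof i \<noteq> 0" for i using cof[of i] m2 by auto
  have z_q: "z x i = q (\<lambda>j. 1 * x j + (- g * q x r) * v j) i" for x i
    unfolding q_lin z_def by simp
  have zw: "z x i = cof i * w x i" if "x \<in> K" for x i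
  proof -
    have "cof i dvd z x i"
      unfolding z_q cof_def by (rule cofactor_dvd_q[OF K_lin[OF that v]])
    then show ?thesis by (simp add: w_def)
  qed
  have K: "x \<in> K" if "x \<in> K0" for x using that by (simp add: K0_def)
  have cong_w: "[a = b] (mod int (modulus i)) \<longleftrightarrow> int m dvd cof i * a - cof i * b" for a b i
  proof -
    have "int m dvd cof i * a - cof i * b \<longleftrightarrow> cof i * int (modulus i) dvd cof i * (a - b)"
      using cof[of i] by (simp add: mult.commute right_diff_distrib)
    then show ?thesis using cof0[of i] by (simp add: cong_iff_dvd_diff)
  qed
  show ?thesis
  proof (rule that[of w])
    fix x y i assume xy: "x \<in> K0" "y \<in> K0"
    have "cof i * w (\<lambda>i. x i + y i) i = cof i * (w x i + w y i)"
      using zw[OF K[OF K0_add[OF xy]], of i] zw[OF K[OF xy(1)], of i] zw[OF K[OF xy(2)], of i]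
      by (simp add: z_def q_add algebra_simps)
    then show "w (\<lambda>i. x i + y i) i = w x i + w y i" using cof0 by simp
  next
    fix x y assume xy: "x \<in> K0" "y \<in> K0"
    define u where "u = (\<lambda>i. x i - y i)"
    have zu: "cof i * w x i - cof i * w y i = z u i" for i
      using zw[OF K[OF xy(1)], of i] zw[OF K[OF xy(2)], of i]
      by (simp add: z_def u_def q_diff algebra_simps)
    have "(\<forall>i<n. i \<noteq> r \<longrightarrow> int m dvd z u i) \<longleftrightarrow> (\<forall>i<n. int m dvd u i)"
    proof
      assume *: "\<forall>i<n. i \<noteq> r \<longrightarrow> int m dvd z u i"
      \<comment> \<open>The excluded coordinate vanishes by itself, so leaving out
        \<open>i = r\<close> loses nothing.\<close>
      have "z u r = - (q u r * (g * q v r - 1))" by (simp add: z_def algebra_simps)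
      then have "int m dvd z u r" using g by simp
      then have "\<forall>i<n. int m dvd z u i" using * by metis
      then have uv: "\<forall>i<n. int m dvd 1 * u i + (- g * q u r) * v i"
        unfolding z_q by (simp only: q_zero)
      have "int m dvd u 0" using xy by (simp add: u_def K0_def)
      then have gv: "int m dvd g * q u r * v 0"
        using uv n_pos by (auto dest!: spec[of _ 0] simp: dvd_diff_right_iff)
      \<comment> \<open>Now \<open>u\<close> is congruent to \<open>g * q u r * v\<close>. As
        \<open>u 0\<close> vanishes and \<open>v 0\<close> has inverse \<open>h\<close>, the
        multiplier vanishes too.\<close>
      have "g * q u r = h * (g * q u r * v 0) - g * q u r * (h * v 0 - 1)"
        by (simp add: algebra_simps)
      then have c: "int m dvd g * q u r" using gv h by (metis dvd_diff dvd_mult)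
      show "\<forall>i<n. int m dvd u i"
      proof (intro allI impI)
        fix i assume "i < n"
        have "u i = (1 * u i + (- g * q u r) * v i) + (g * q u r) * v i" by simp
        then show "int m dvd u i" using uv \<open>i < n\<close> c by (metis dvd_add dvd_mult2)
      qed
    next
      assume "\<forall>i<n. int m dvd u i"
      then have "\<forall>i<n. int m dvd q u i" by (simp add: q_zero)
      then show "\<forall>i<n. i \<noteq> r \<longrightarrow> int m dvd z u i"
        using r_less by (auto simp: z_def)
    qed
    then show "(\<forall>i<n. i \<noteq> r \<longrightarrow> [w x i = w y i] (mod int (modulus i))) \<longleftrightarrow> (\<forall>i<n. [x i = y i] (mod int m))"
      unfolding cong_w zu by (simp add: cong_iff_dvd_diff u_def)
  next
    fix t :: "nat \<Rightarrow> int"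
    \<comment> \<open>Multiplication by the cofactors puts the prescribed values into the
      annihilators; the coordinate to be cancelled is set to 0.\<close>
    define z' where "z' i = (if i = r then 0 else cof i * t i)" for i
    obtain y where y: "\<forall>k<n. int m dvd q y k - z' k" using q_surj by blast
    have "y \<in> K"
      unfolding K_def
    proof safe
      fix k assume k: "k < r"
      have "int (d k) * z' k = int m * t k"
        using cof[of k] k by (simp add: z'_def modulus_def mult.assoc[symmetric])
      then have "int (d k) * q y k = int (d k) * (q y k - z' k) + int m * t k"
        by (simp add: right_diff_distrib)
      then show "int m dvd int (d k) * q y k" using y k r_less by simp
    qed
    \<comment> \<open>The multiple of \<open>v\<close> that makes the entry at 0 vanish modulo
      \<open>m\<close>.\<close>
    define c where "c = h * y 0"
    define x where "x = (\<lambda>i. 1 * y i + (- c) * v i)"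
    have "x \<in> K" unfolding x_def by (rule K_lin[OF \<open>y \<in> K\<close> v])
    have "x 0 = - (y 0 * (h * v 0 - 1))" by (simp add: x_def c_def algebra_simps)
    then have "x \<in> K0" using h \<open>x \<in> K\<close> by (simp add: K0_def)
    moreover have "[w x i = t i] (mod int (modulus i))" if i: "i < n" "i \<noteq> r" for i
    proof -
      have qx: "q x k = q y k - c * q v k" for k unfolding x_def q_lin by simp
      \<comment> \<open>Subtracting a multiple of \<open>v\<close> does not change \<open>z\<close>
        modulo \<open>m\<close>, because \<open>z\<close> is the projection along
        \<open>v\<close>.\<close>
      have "z x i - z' i = (q y i - z' i) - (g * q v i) * (q y r - z' r) + c * q v i * (g * q v r - 1)"
        by (simp add: z_def qx z'_def algebra_simps)
      moreover have "int m dvd q y i - z' i" "int m dvd q y r - z' r" using y i r_less by auto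
      ultimately have "int m dvd z x i - z' i" using g by (simp only: dvd_add dvd_diff dvd_mult)
      then show ?thesis
        unfolding cong_w using i zw[OF \<open>x \<in> K\<close>, of i] by (simp add: z'_def)
    qed
    ultimately show "\<exists>x\<in>K0. \<forall>i<n. i \<noteq> r \<longrightarrow> [w x i = t i] (mod int (modulus i))" by blast
  qed
qed

end

section \<open>Roots of unity and the decomposition\<close>

text \<open>Two surjections with the same fibres that respect \<open>plus_L\<close> induce an
  isomorphism of their targets. With integer lifts as \<open>L\<close>, no quotient group has to be
  formed.\<close>

lemma is_iso_if_common_hom_source:
  fixes G :: "('b, 'c) monoid_scheme" and H :: "('d, 'e) monoid_scheme"
  assumes closed: "\<And>x y. x \<in> L \<Longrightarrow> y \<in> L \<Longrightarrow> plus_L x y \<in> L"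
    and f: "f ` L = carrier G" "\<And>x y. x \<in> L \<Longrightarrow> y \<in> L \<Longrightarrow> f (plus_L x y) = f x \<otimes>\<^bsub>G\<^esub> f y"
    and g: "g ` L = carrier H" "\<And>x y. x \<in> L \<Longrightarrow> y \<in> L \<Longrightarrow> g (plus_L x y) = g x \<otimes>\<^bsub>H\<^esub> g y"
    and same: "\<And>x y. x \<in> L \<Longrightarrow> y \<in> L \<Longrightarrow> f x = f y \<longleftrightarrow> g x = g y"
  shows "G \<cong> H"
proof -
  define h where "h = g \<circ> inv_into L f"
  have hf: "h (f x) = g x" if "x \<in> L" for x
    unfolding h_def comp_def
    using that same[OF inv_into_into[of "f x" f L] that] f_inv_into_f[of "f x" f L] by simp
  have "h \<in> hom G H"
  proof (rule homI)
    fix a assume "a \<in> carrier G"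
    then obtain x where "x \<in> L" "a = f x" using f(1) by blast
    then show "h a \<in> carrier H" using g(1) hf by auto
  next
    fix a b assume "a \<in> carrier G" "b \<in> carrier G"
    then obtain x y where "x \<in> L" "y \<in> L" "a = f x" "b = f y" using f(1) by blast
    then show "h (a \<otimes>\<^bsub>G\<^esub> b) = h a \<otimes>\<^bsub>H\<^esub> h b"
      using f(2) g(2) hf closed by metis
  qed
  moreover have "bij_betw h (carrier G) (carrier H)"
  proof (rule bij_betw_imageI)
    show "inj_on h (carrier G)"
      using hf same by (auto simp: f(1)[symmetric] intro!: inj_onI)
    show "h ` carrier G = carrier H"
      unfolding f(1)[symmetric] g(1)[symmetric] using hf by (auto simp: image_image)
  qed
  ultimately show ?thesis by (auto simp: is_iso_def iso_def)
qed

lemma cis_eq_iff_cong: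
  assumes "m > 0"
  shows "cis (2 * pi * real_of_int a / real m) = cis (2 * pi * real_of_int b / real m) \<longleftrightarrow>
    [a = b] (mod int m)"
proof -
  have "cis (2 * pi * real_of_int a / real m) = cis (2 * pi * real_of_int b / real m) \<longleftrightarrow>
      cis (2 * pi * real_of_int (a - b) / real m) = 1"
    by (simp add: cis_divide[symmetric] diff_divide_distrib right_diff_distrib)
  also have "\<dots> \<longleftrightarrow> (\<exists>k. 2 * pi * real_of_int (a - b) / real m = of_int k * (2 * pi))"
    by (rule cis_eq_1_iff)
  also have "\<dots> \<longleftrightarrow> (\<exists>k. real_of_int (a - b) = real_of_int (int m * k))"
  proof -
    have "2 * pi * real_of_int (a - b) / real m = of_int k * (2 * pi) \<longleftrightarrow>
        (2 * pi) * real_of_int (a - b) = (2 * pi) * real_of_int (int m * k)" for k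
      using assms by (simp add: divide_eq_eq mult_ac)
    then show ?thesis unfolding mult_cancel_left by simp
  qed
  also have "\<dots> \<longleftrightarrow> [a = b] (mod int m)"
    unfolding of_int_eq_iff cong_iff_dvd_diff dvd_def ..
  finally show ?thesis .
qed

lemma sum_incidence_eq:
  assumes "is \<in> tidx k n"
  shows "(\<Sum>l<n. incidence is l * x l) = sum_list (map x is)"
proof -
  have "set is \<subseteq> {..<n}" using assms by (simp add: tidx_def)
  then show ?thesis
  proof (induction "is")
    case (Cons a xs)
    have "(\<Sum>l<n. incidence (a # xs) l * x l) = (\<Sum>l<n. (if l = a then x l else 0) + incidence xs l * x l)"
      by (intro sum.cong) (auto simp: incidence_def algebra_simps)
    also have "\<dots> = x a + (\<Sum>l<n. incidence xs l * x l)"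
      using Cons.prems by (simp add: sum.distrib)
    finally show ?case using Cons by simp
  qed (simp add: incidence_def)
qed

context comb_z_tensor
begin

definition zeta :: "(nat \<Rightarrow> int) \<Rightarrow> nat \<Rightarrow> complex" where
  "zeta x i = (if i < n then cis (2 * pi * real_of_int (x i) / real m) else 0)"

lemma prod_list_zeta:
  assumes "is \<in> tidx k n"
  shows "prod_list (map (zeta x) is) = cis (2 * pi * real_of_int (sum_list (map x is)) / real m)"
proof -
  have "set is \<subseteq> {..<n}" using assms by (simp add: tidx_def)
  then show ?thesis
    by (induction "is") (auto simp: zeta_def cis_mult add_divide_distrib distrib_left)
qed

lemma zeta_power: "i < n \<Longrightarrow> zeta x i ^ m = 1"
proof -
  assume "i < n"
  then have "zeta x i ^ m = cis (2 * pi * real_of_int (x i))"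
    using m2 by (simp add: zeta_def Complex.DeMoivre)
  then show ?thesis by (metis Ints_of_int cis_multiple_2pi)
qed

text \<open>A row of the incidence matrix applied to \<open>x\<close> sums \<open>x\<close> over the
  edge with multiplicity. Sorting keeps this sum and, by combinatorial symmetry, the support, so the
  sorted edges account for all index lists.\<close>

lemma kernel_iff:
  "x \<in> kernel_Zm A m n \<longleftrightarrow> (\<forall>is\<in>tidx m n. A is \<noteq> 0 \<longrightarrow> int m dvd sum_list (map x is))"
proof
  assume x: "x \<in> kernel_Zm A m n"
  show "\<forall>is\<in>tidx m n. A is \<noteq> 0 \<longrightarrow> int m dvd sum_list (map x is)"
  proof (intro ballI impI)
    fix "is" assume "is": "is \<in> tidx m n" "A is \<noteq> 0"
    have s: "sort is \<in> tidx m n" using "is"(1) by (simp add: tidx_def)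
    moreover have "A (sort is) \<noteq> 0"
      using A_sym "is" s unfolding comb_symmetric_def by (metis mset_sort)
    ultimately have "sort is \<in> edges A m n" by (simp add: edges_def)
    then have "int m dvd sum_list (map x (sort is))"
      using x sum_incidence_eq[OF s, of x] by (auto simp: kernel_Zm_def)
    moreover have "sum_list (map x (sort is)) = sum_list (map x is)"
      by (metis mset_map mset_sort sum_mset_sum_list)
    ultimately show "int m dvd sum_list (map x is)" by simp
  qed
next
  assume x: "\<forall>is\<in>tidx m n. A is \<noteq> 0 \<longrightarrow> int m dvd sum_list (map x is)"
  then show "x \<in> kernel_Zm A m n"
    using sum_incidence_eq[of _ m n x] by (auto simp: kernel_Zm_def edges_def)
qed

text \<open>For an \<open>m\<close>-th root of unity \<open>D i ^ (m - 1)\<close> is the inverse of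
  \<open>D i\<close>, so the stabiliser condition becomes symmetric in the indices of the
  edge.\<close>

lemma stabs_iff_prod_list:
  fixes D :: "nat \<Rightarrow> complex"
  assumes "\<And>i. i < n \<Longrightarrow> D i ^ m = 1" "is \<in> tidx m n"
  shows "prod_list (map D (tl is)) = D (hd is) ^ (m - 1) \<longleftrightarrow> prod_list (map D is) = 1"
proof -
  obtain i xs where is_eq: "is = i # xs" and i: "i < n" using hd_tidx[OF assms(2)] by blast
  have D1: "D i * D i ^ (m - 1) = 1"
    using assms(1)[OF i] m2 by (cases m) auto
  then have "D i \<noteq> 0" by auto
  then have "prod_list (map D xs) = D i ^ (m - 1) \<longleftrightarrow> D i * prod_list (map D xs) = D i * D i ^ (m - 1)"
    by (simp only: mult_cancel_left simp_thms)
  then show ?thesis unfolding is_eq D1 by simp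
qed

lemma stabs_eq_zeta_image: "stabs = zeta ` {x \<in> kernel_Zm A m n. int m dvd x 0}"
proof (intro equalityI subsetI)
  fix D assume D: "D \<in> stabs"
  have "\<exists>k. D i = cis (2 * pi * real_of_int k / real m)" if i: "i < n" for i
  proof -
    have "D i \<in> {z. z ^ m = 1}" using stabs_root[OF D i] by simp
    then have "D i \<in> (\<lambda>k. cis (2 * pi * real k / real m)) ` {..<m}"
      using Complex.bij_betw_roots_unity[of m] m2 by (simp add: bij_betw_def)
    then show ?thesis by (metis (no_types, lifting) imageE of_int_of_nat_eq)
  qed
  then obtain x where x: "\<And>i. i < n \<Longrightarrow> D i = cis (2 * pi * real_of_int (x i) / real m)"
    by metis
  have Dz: "D = zeta x"
    using D by (auto simp: fun_eq_iff zeta_def x stabs_def)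
  have "x \<in> kernel_Zm A m n"
    unfolding kernel_iff
  proof (intro ballI impI)
    fix "is" assume "is": "is \<in> tidx m n" "A is \<noteq> 0"
    have "prod_list (map D is) = 1"
      using stabs_iff_prod_list[of D, OF stabs_root[OF D] "is"(1)] D "is" by (simp add: stabs_def)
    then have "cis (2 * pi * real_of_int (sum_list (map x is)) / real m) = cis (2 * pi * real_of_int 0 / real m)"
      unfolding Dz prod_list_zeta[OF "is"(1)] by simp
    then show "int m dvd sum_list (map x is)"
      using cis_eq_iff_cong[of m "sum_list (map x is)" 0] m2 by (simp add: cong_0_iff)
  qed
  moreover have "cis (2 * pi * real_of_int (x 0) / real m) = cis (2 * pi * real_of_int 0 / real m)"
    using D x[of 0] n2 by (simp add: stabs_def)
  then have "int m dvd x 0"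
    using cis_eq_iff_cong[of m "x 0" 0] m2 by (simp add: cong_0_iff)
  ultimately show "D \<in> zeta ` {x \<in> kernel_Zm A m n. int m dvd x 0}" using Dz by blast
next
  fix D assume "D \<in> zeta ` {x \<in> kernel_Zm A m n. int m dvd x 0}"
  then obtain x where x: "x \<in> kernel_Zm A m n" "int m dvd x 0" and D: "D = zeta x" by blast
  have "zeta x 0 = 1"
    using cis_eq_iff_cong[of m "x 0" 0] m2 n2 x(2) by (simp add: cong_0_iff zeta_def)
  moreover have "prod_list (map D (tl is)) = D (hd is) ^ (m - 1)" if "is": "is \<in> tidx m n" "A is \<noteq> 0" for "is"
  proof -
    have "int m dvd sum_list (map x is)" using x(1) "is" by (simp add: kernel_iff)
    then have "prod_list (map D is) = 1"
      unfolding D prod_list_zeta[OF "is"(1)]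
      using cis_eq_iff_cong[of m "sum_list (map x is)" 0] m2 by (simp add: cong_0_iff)
    then show ?thesis
      using stabs_iff_prod_list[of D "is"] zeta_power "is" by (simp add: D)
  qed
  ultimately show "D \<in> stabs" by (auto simp: stabs_def D zeta_def)
qed

lemma eig_of_zeta_eq_iff:
  assumes "zeta x \<in> stabs" "zeta y \<in> stabs"
  shows "eig_of (zeta x) = eig_of (zeta y) \<longleftrightarrow> (\<forall>i<n. [x i = y i] (mod int m))"
proof -
  have "eig_of (zeta x) = eig_of (zeta y) \<longleftrightarrow> zeta x = zeta y"
    using inj_eig_of assms by (auto dest: inj_onD)
  also have "\<dots> \<longleftrightarrow> (\<forall>i<n. zeta x i = zeta y i)"
    by (auto simp: zeta_def fun_eq_iff)
  also have "\<dots> \<longleftrightarrow> (\<forall>i<n. [x i = y i] (mod int m))"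
    using cis_eq_iff_cong[of m] m2 by (simp add: zeta_def)
  finally show ?thesis .
qed

text \<open>Every row of the incidence matrix sums to \<open>m\<close>.\<close>

lemma ones_in_kernel: "(\<lambda>_. 1) \<in> kernel_Zm A m n"
  unfolding kernel_iff by (auto simp: tidx_def sum_list_triv)

text \<open>An edge with head 0 that contains some \<open>i\<close> other than 0 has between 1 and
  \<open>m - 1\<close> occurrences of \<open>i\<close>, so the indicator of \<open>i\<close> is not
  in the kernel. This is the source of \<open>1 \<le> r\<close>.\<close>

lemma kernel_not_full: "\<exists>x. x \<notin> kernel_Zm A m n"
proof -
  have "(0, 1) \<in> (wi_arc A m n)\<^sup>*" using A_conn n2 by (auto simp: weakly_irreducible_def)
  then obtain i where "(0, i) \<in> wi_arc A m n" by (metis converse_rtranclE zero_neq_one)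
  then obtain xs where xs: "xs \<in> tidx (m - 1) n" "A (0 # xs) \<noteq> 0" "i \<in> set xs" "i \<noteq> 0"
    by (auto simp: wi_arc_def)
  define x :: "nat \<Rightarrow> int" where "x j = (if j = i then 1 else 0)" for j
  have "sum_list (map x ys) = int (count_list ys i)" for ys
    by (induction ys) (auto simp: x_def)
  then have s: "sum_list (map x (0 # xs)) = int (count_list xs i)" using xs(4) by (simp add: x_def)
  have "count_list xs i \<noteq> 0" using xs(3) by (simp add: count_list_0_iff)
  moreover have "count_list xs i \<le> m - 1" using count_le_length[of xs i] xs(1) by (simp add: tidx_def)
  ultimately have "\<not> int m dvd sum_list (map x (0 # xs))"
    unfolding s using m2 by (auto dest!: dvd_imp_le)
  moreover have "0 # xs \<in> tidx m n" using Cons_tidx xs n2 by auto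
  ultimately show ?thesis unfolding kernel_iff using xs(2) by blast
qed

end

section \<open>The target group and the final assembly\<close>

lemma card_carrier_decomp_group:
  assumes "\<And>k. k \<in> set L \<Longrightarrow> 0 < k"
  shows "card (carrier (decomp_group L)) = prod_list L"
proof -
  have "card (carrier (decomp_group L)) = (\<Prod>j<length L. card (carrier (integer_mod_group (L ! j))))"
    by (simp add: decomp_group_def card_PiE)
  also have "\<dots> = (\<Prod>j<length L. L ! j)"
    using assms by (intro prod.cong) (auto simp: carrier_integer_mod_group)
  also have "\<dots> = prod_list L" by (simp add: prod.list_conv_set_nth atLeast0LessThan)
  finally show ?thesis .
qed

lemma prod_list_snf_moduli: "prod_list (snf_moduli m n r d) = m ^ (n - 1 - r) * (\<Prod>i<r. d i)"
proof -
  have "prod_list (filter (\<lambda>k. k \<noteq> 1) xs) = prod_list xs" for xs :: "nat list"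
    by (induction xs) auto
  moreover have "prod_list (map d [0..<r]) = (\<Prod>i<r. d i)"
    by (simp add: prod.list_conv_set_nth atLeast0LessThan)
  ultimately show ?thesis by (simp add: snf_moduli_def)
qed

text \<open>The coordinates that carry the listed factors, in the same order. Index \<open>r\<close>
  is missing because its copy of the integers modulo \<open>m\<close> is the cancelled one.\<close>

definition snf_indices :: "nat \<Rightarrow> nat \<Rightarrow> (nat \<Rightarrow> nat) \<Rightarrow> nat list" where
  "snf_indices n r d = filter (\<lambda>i. d i \<noteq> 1) [0..<r] @ [Suc r..<n]"

lemma (in kernel_coordinates) snf_moduli_eq:
  "snf_moduli m n r d = map modulus (snf_indices n r d)"
proof -
  have "filter (\<lambda>k. k \<noteq> 1) (map d [0..<r]) = map modulus (filter (\<lambda>i. d i \<noteq> 1) [0..<r])"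
    by (auto simp: filter_map comp_def modulus_def)
  moreover have "replicate (n - 1 - r) m = map modulus [Suc r..<n]"
    by (auto simp: modulus_def list_eq_iff_nth_eq)
  ultimately show ?thesis by (simp add: snf_moduli_def snf_indices_def)
qed

text \<open>\<open>g\<close> reduces the coordinates \<open>w\<close> to the standard
  representatives. Dropping the indices of modulus 1 keeps the fibres, since congruence modulo 1
  always holds.\<close>

lemma (in kernel_coordinates) decomp_group_image:
  obtains g where "g ` K0 = carrier (decomp_group (snf_moduli m n r d))"
    "\<And>x y. x \<in> K0 \<Longrightarrow> y \<in> K0 \<Longrightarrow>
      g (\<lambda>i. x i + y i) = g x \<otimes>\<^bsub>decomp_group (snf_moduli m n r d)\<^esub> g y"
    "\<And>x y. x \<in> K0 \<Longrightarrow> y \<in> K0 \<Longrightarrow> g x = g y \<longleftrightarrow> (\<forall>i<n. [x i = y i] (mod int m))"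
proof -
  obtain w :: "(nat \<Rightarrow> int) \<Rightarrow> nat \<Rightarrow> int" where
    w_add: "\<And>x y i. x \<in> K0 \<Longrightarrow> y \<in> K0 \<Longrightarrow> w (\<lambda>i. x i + y i) i = w x i + w y i"
    and w_eq: "\<And>x y. x \<in> K0 \<Longrightarrow> y \<in> K0 \<Longrightarrow>
      (\<forall>i<n. i \<noteq> r \<longrightarrow> [w x i = w y i] (mod int (modulus i))) \<longleftrightarrow> (\<forall>i<n. [x i = y i] (mod int m))"
    and w_surj: "\<And>t. \<exists>x\<in>K0. \<forall>i<n. i \<noteq> r \<longrightarrow> [w x i = t i] (mod int (modulus i))"
    by (rule kernel_decomposition) (rule that)
  define J where "J = snf_indices n r d"
  define N where "N = length J"
  have J_set: "set J = {i. i < n \<and> i \<noteq> r \<and> modulus i \<noteq> 1}"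
    using r_less m2 by (auto simp: J_def snf_indices_def modulus_def)
  have J_dist: "distinct J" by (auto simp: J_def snf_indices_def)
  have pos: "0 < modulus i" for i
    using modulus_dvd[of i] m2 by (intro gr0I notI) simp
  define g where "g x = (\<lambda>j\<in>{..<N}. w x (J ! j) mod int (modulus (J ! j)))" for x
  have carrier: "carrier (decomp_group (snf_moduli m n r d)) = (\<Pi>\<^sub>E j\<in>{..<N}. {0..<int (modulus (J ! j))})"
    unfolding snf_moduli_eq decomp_group_def carrier_product_group J_def[symmetric] N_def
  proof -
    have "carrier (integer_mod_group (map modulus J ! j)) = {0..<int (modulus (J ! j))}"
      if "j \<in> {..<length J}" for j
      using that pos[of "J ! j"] by (simp add: carrier_integer_mod_group)
    then show "(\<Pi>\<^sub>E i\<in>{..<length (map modulus J)}. carrier (integer_mod_group (map modulus J ! i)))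
        = (\<Pi>\<^sub>E j\<in>{..<length J}. {0..<int (modulus (J ! j))})"
      unfolding length_map by (rule PiE_cong)
  qed
  have mult: "x \<otimes>\<^bsub>decomp_group (snf_moduli m n r d)\<^esub> y
      = (\<lambda>j\<in>{..<N}. (x j + y j) mod int (modulus (J ! j)))" for x y
    unfolding snf_moduli_eq decomp_group_def J_def[symmetric] N_def product_group_def
    by (auto simp: fun_eq_iff)
  show ?thesis
  proof (rule that[of g])
    fix x y assume xy: "x \<in> K0" "y \<in> K0"
    show "g (\<lambda>i. x i + y i) = g x \<otimes>\<^bsub>decomp_group (snf_moduli m n r d)\<^esub> g y"
      unfolding mult g_def using w_add[OF xy] by (auto simp: fun_eq_iff mod_add_eq)
    have "g x = g y \<longleftrightarrow> (\<forall>j<N. [w x (J ! j) = w y (J ! j)] (mod int (modulus (J ! j))))"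
      unfolding g_def fun_eq_iff cong_def by auto
    also have "\<dots> \<longleftrightarrow> (\<forall>i\<in>set J. [w x i = w y i] (mod int (modulus i)))"
      by (auto simp: N_def all_set_conv_all_nth)
    also have "\<dots> \<longleftrightarrow> (\<forall>i<n. i \<noteq> r \<longrightarrow> [w x i = w y i] (mod int (modulus i)))"
    proof -
      have "[w x i = w y i] (mod int (modulus i))" if "modulus i = 1" for i
        using that by (simp add: cong_iff_dvd_diff)
      then show ?thesis unfolding J_set by blast
    qed
    finally show "g x = g y \<longleftrightarrow> (\<forall>i<n. [x i = y i] (mod int m))" using w_eq[OF xy] by simp
  next
    show "g ` K0 = carrier (decomp_group (snf_moduli m n r d))"
      unfolding carrier
    proof (intro equalityI subsetI)
      fix s assume "s \<in> g ` K0"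
      then obtain x where "s = g x" by blast
      then show "s \<in> (\<Pi>\<^sub>E j\<in>{..<N}. {0..<int (modulus (J ! j))})"
        by (simp add: g_def pos)
    next
      fix s assume s: "s \<in> (\<Pi>\<^sub>E j\<in>{..<N}. {0..<int (modulus (J ! j))})"
      \<comment> \<open>Reads a tuple indexed by positions in \<open>J\<close> as a function of the
        entries of \<open>J\<close>; distinctness of \<open>J\<close> makes the position
        unique.\<close>
      define t where "t i = s (THE j. j < N \<and> J ! j = i)" for i
      have t: "t (J ! j) = s j" if "j < N" for j
      proof -
        have "(THE j'. j' < N \<and> J ! j' = J ! j) = j"
          using that J_dist by (intro the_equality) (auto simp: N_def nth_eq_iff_index_eq)
        then show ?thesis by (simp add: t_def)
      qed
      obtain x where x: "x \<in> K0" "\<forall>i<n. i \<noteq> r \<longrightarrow> [w x i = t i] (mod int (modulus i))"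
        using w_surj by blast
      have "g x = s"
      proof
        fix j
        show "g x j = s j"
        proof (cases "j < N")
          case True
          then have "J ! j \<in> set J" by (simp add: N_def)
          then have "[w x (J ! j) = s j] (mod int (modulus (J ! j)))"
            using x(2)[rule_format, of "J ! j"] t[OF True] unfolding J_set by simp
          moreover have "0 \<le> s j" "s j < int (modulus (J ! j))"
            using PiE_mem[OF s, of j] True by simp_all
          ultimately show ?thesis using True by (simp add: g_def cong_def)
        next
          case False
          then show ?thesis using PiE_arb[OF s, of j] by (simp add: g_def)
        qed
      qed
      then show "s \<in> g ` K0" using x(1) by blast
    qed
  qed
qed

theorem theorem3p3:
  fixes A :: "nat list \<Rightarrow> real" and m n r :: nat and d :: "nat \<Rightarrow> nat"
  assumes "m \<ge> 2" and "n \<ge> 2"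
    and "comb_symmetric A m n" and "weakly_irreducible A m n" and "z_tensor A m n"
    and "snf_Zm A m n r d"
  shows "(1 \<le> r \<and> r \<le> n - 1)
         \<and> (comm_group (PV_group A m n)
         \<and> (\<forall>y\<in>carrier (PV_group A m n). y [^]\<^bsub>PV_group A m n\<^esub> m = \<one>\<^bsub>PV_group A m n\<^esub>)
         \<and> PV_group A m n \<cong> decomp_group (snf_moduli m n r d))
         \<and> (stab_index A m n = card (PV A m n (complex_of_real (lambda_min A m n)))
         \<and> card (PV A m n (complex_of_real (lambda_min A m n))) = m ^ (n - 1 - r) * (\<Prod>i<r. d i))"
proof -
  interpret comb_z_tensor A m n
    using assms by unfold_locales auto
  have fin: "finite (edges A m n)" by (simp add: edges_def)
  obtain q where q:
    "\<And>a b x y k. q (\<lambda>i. a * x i + b * y i) k = a * q x k + b * q y k"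
    "\<And>x. (\<forall>k<n. int m dvd q x k) \<longleftrightarrow> (\<forall>i<n. int m dvd x i)"
    "\<And>z. \<exists>x. \<forall>k<n. int m dvd q x k - z k"
    and ker: "\<And>x. x \<in> kernel_Zm A m n \<longleftrightarrow> (\<forall>k<r. int m dvd int (d k) * q x k)"
    by (rule snf_Zm_coordinates[OF assms(6) fin]) (rule that)
  have rn: "r \<le> n" and d: "\<And>i. i < r \<Longrightarrow> 1 \<le> d i \<and> d i \<le> m - 1 \<and> d i dvd m"
    and d_chain: "\<And>i. Suc i < r \<Longrightarrow> d i dvd d (Suc i)"
    using assms(6) by (auto simp: snf_Zm_def Let_def)
  have q_ones: "int m dvd int (d k) * q (\<lambda>_. 1) k" if "k < r" for k
    using ones_in_kernel ker that by blast
  \<comment> \<open>With \<open>r = 0\<close> there would be no kernel condition at all.\<close>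
  have r1: "1 \<le> r"
    using kernel_not_full ker by (cases r) auto
  have rn': "r < n"
  proof (rule ccontr)
    assume "\<not> r < n"
    then have r: "r = n" using rn by simp
    \<comment> \<open>The last diagonal entry is a multiple of all the others, so \<open>D\<close>
      times the all-ones vector has every coordinate divisible by \<open>m\<close>. Then
      \<open>m\<close> divides \<open>D\<close>, against \<open>D \<le> m - 1\<close>.\<close>
    define D where "D = d (n - 1)"
    have D_dvd: "d (n - 1 - j) dvd D" for j
    proof (induction j)
      case (Suc j)
      show ?case
      proof (cases "Suc j \<le> n - 1")
        case True
        then have "Suc (n - 1 - Suc j) = n - 1 - j" by simp
        then have "d (n - 1 - Suc j) dvd d (n - 1 - j)"
          using d_chain[of "n - 1 - Suc j"] r True n2 by simp
        then show ?thesis using Suc dvd_trans by blast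
      next
        case False
        then have "n - 1 - Suc j = n - 1 - j" by simp
        then show ?thesis using Suc by simp
      qed
    qed (simp add: D_def)
    \<comment> \<open>The constant vector is written as a linear combination so that the linearity
      of \<open>q\<close> applies to it literally.\<close>
    have "int m dvd q (\<lambda>i. int D * 1 + 0 * 1) k" if "k < n" for k
    proof -
      have "d k dvd D" using D_dvd[of "n - 1 - k"] that by simp
      then obtain c where "D = d k * c" by blast
      then have "int D * q (\<lambda>_. 1) k = c * (int (d k) * q (\<lambda>_. 1) k)" by simp
      moreover have "int m dvd c * (int (d k) * q (\<lambda>_. 1) k)"
        by (rule dvd_mult) (rule q_ones, simp add: r that)
      ultimately have "int m dvd int D * q (\<lambda>_. 1) k" by metis
      then show ?thesis unfolding q(1) by simp
    qed
    then have "\<forall>i<n. int m dvd int D * 1 + 0 * 1"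
      using q(2)[of "\<lambda>i. int D * 1 + 0 * 1"] by blast
    moreover have "0 < n" using n2 by simp
    ultimately have "int m dvd int D * 1 + 0 * 1" by blast
    then have "m dvd D" by simp
    then show False using d[of "n - 1"] r n2 by (auto simp: D_def dest!: dvd_imp_le)
  qed
  interpret kernel_coordinates q m n r d
    using assms(1,2) rn' d q_ones q by unfold_locales auto
  have K0: "K0 = {x \<in> kernel_Zm A m n. int m dvd x 0}"
    by (auto simp: K0_def K_def ker)
  have zeta_stabs: "zeta x \<in> stabs" if "x \<in> K0" for x
    using that by (auto simp: stabs_eq_zeta_image K0)
  obtain g where g: "g ` K0 = carrier (decomp_group (snf_moduli m n r d))"
    "\<And>x y. x \<in> K0 \<Longrightarrow> y \<in> K0 \<Longrightarrow>
      g (\<lambda>i. x i + y i) = g x \<otimes>\<^bsub>decomp_group (snf_moduli m n r d)\<^esub> g y"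
    "\<And>x y. x \<in> K0 \<Longrightarrow> y \<in> K0 \<Longrightarrow> g x = g y \<longleftrightarrow> (\<forall>i<n. [x i = y i] (mod int m))"
    by (rule decomp_group_image) (rule that)
  \<comment> \<open>Both groups are images of the integer vectors in \<open>K0\<close>, and in both
    two vectors are identified exactly when they agree modulo \<open>m\<close> on the index
    range.\<close>
  have iso: "PV_group A m n \<cong> decomp_group (snf_moduli m n r d)"
  proof (rule is_iso_if_common_hom_source[where L = K0 and plus_L = "\<lambda>x y i. x i + y i"
        and f = "\<lambda>x. eig_of (zeta x)" and g = g])
    show "(\<lambda>x. eig_of (zeta x)) ` K0 = carrier (PV_group A m n)"
      unfolding carrier_PV_group stabs_eq_zeta_image K0 by (simp add: image_image)
    fix x y assume xy: "x \<in> K0" "y \<in> K0"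
    show "(\<lambda>i. x i + y i) \<in> K0" using xy by (rule K0_add)
    have "zeta (\<lambda>i. x i + y i) = (\<lambda>i. zeta x i * zeta y i)"
      by (auto simp: zeta_def cis_mult fun_eq_iff add_divide_distrib distrib_left)
    then show "eig_of (zeta (\<lambda>i. x i + y i)) = eig_of (zeta x) \<otimes>\<^bsub>PV_group A m n\<^esub> eig_of (zeta y)"
      using mult_PV_group[OF zeta_stabs[OF xy(1)] zeta_stabs[OF xy(2)]] by simp
    show "eig_of (zeta x) = eig_of (zeta y) \<longleftrightarrow> g x = g y"
      using eig_of_zeta_eq_iff[OF zeta_stabs[OF xy(1)] zeta_stabs[OF xy(2)]] g(3)[OF xy] by simp
  qed (use g in auto)
  have "card stabs = card (carrier (PV_group A m n))"
    unfolding carrier_PV_group by (rule card_image[OF inj_eig_of, symmetric])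
  also have "\<dots> = card (carrier (decomp_group (snf_moduli m n r d)))"
    using iso_same_card iso by blast
  also have "\<dots> = m ^ (n - 1 - r) * (\<Prod>i<r. d i)"
  proof -
    have "0 < d i" if "i < r" for i using d[OF that] by simp
    then have "0 < k" if "k \<in> set (snf_moduli m n r d)" for k
      using that m2 by (auto simp: snf_moduli_def)
    then show ?thesis by (simp add: card_carrier_decomp_group prod_list_snf_moduli)
  qed
  finally have card: "card stabs = m ^ (n - 1 - r) * (\<Prod>i<r. d i)" .
  have "r \<le> n - 1" using rn' by simp
  then show ?thesis
    unfolding stab_index_eq card_PV
    using r1 iso comm_group_PV_group pow_m_PV_group card by blast
qed

end
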